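(* Suppose there is a first-order Darboux transformation $(M,N)\colon L \rightarrow L_1$ with $L,N,M,L_1 \in K[\partial_t,\partial_{x_1},\dots,\partial_{x_n}]$, and $M=\partial_t+m$ with $m\in K$. Then this transformation is either of Type I or of Wronskian type.
   Context: $K$ is a differential field of characteristic zero with commuting derivations $\partial_t,\partial_{x_1},\dots,\partial_{x_n}$, and $K[\partial_t,\partial_{x_1},\dots,\partial_{x_n}]$ is the ring of linear partial differential operators over $K$. Standing convention: either $K$ is differentially closed, or $K$ is assumed to contain the solutions of the partial differential equations encountered. Elements of $K$ are called functions. $\ker L$ is the set of $\phi\in K$ with $L[\phi]=0$. $\sigma(L)$ denotes the principal symbol of $L$. A Darboux transformation $(M,N)\colon L\to L_1$, where $\sigma(L)=\sigma(L_1)$, is a pair of operators $(M,N)$ satisfying $NL=L_1M$. The order of a Darboux transformation $(M,N)\colon L\to L_1$ is the least possible order of an operator of the form $M+AL$ with $A\in K[\partial_t,\partial_{x_1},\dots,\partial_{x_n}]$. A Darboux transformation $(M,N)\colon L\to L_1$ is of Type I if there are an operator $C$ and a nonzero function $f\in K$ with $L=CM+f$, $N=M^{1/f}:=fM(1/f)$, and $L_1=M^{1/f}C+f$. A Darboux transformation $(M,N)\colon L\to L_1$ is of Wronskian type if, after a change of variables, $M$ can be put in the form $M(f)=\dfrac{W(f_1,\dots,f_m,f)}{W(f_1,\dots,f_m)}$, where $W$ denotes the Wronskian determinant with respect to one of the variables $t,x_1,\dots,x_n$, and $f_1,\dots,f_m\in K$ ($m\ge1$) are linearly independent elements of $\ker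 L$. (For $m=1$ with respect to $t$ this is $M=\partial_t-\psi_t\psi^{-1}$ with $0\ne\psi\in\ker L$.) *)

theory Defs
  imports
    "HOL-Library.Poly_Mapping"
    "HOL-Algebra.Ring"
    "Jordan_Normal_Form.Determinant"
    "Jordan_Normal_Form.VS_Connect"
begin

definition diff_field :: "('i \<Rightarrow> 'k \<Rightarrow> 'k::field_char_0) \<Rightarrow> bool" where
  "diff_field D \<longleftrightarrow>
     (\<forall>i a b. D i (a + b) = D i a + D i b) \<and>
     (\<forall>i a b. D i (a * b) = D i a * b + a * D i b) \<and>
     (\<forall>i j a. D i (D j a) = D j (D i a))"

definition constants :: "('i \<Rightarrow> 'k \<Rightarrow> 'k::field_char_0) \<Rightarrow> 'k set" where
  "constants D = {c. \<forall>i. D i c = 0}"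

text \<open>
  \<^term>\<open>diff_extension D R d \<iota>\<close>: the field \<^term>\<open>R\<close> with the commuting derivations \<^term>\<open>d\<close> is a
  differential field extension, via the embedding \<^term>\<open>\<iota>\<close>, of the field \<open>'k\<close> with the
  derivations \<^term>\<open>D\<close>.
\<close>

definition diff_extension ::
  "('i \<Rightarrow> 'k \<Rightarrow> 'k::field_char_0) \<Rightarrow> 'e ring \<Rightarrow> ('i \<Rightarrow> 'e \<Rightarrow> 'e) \<Rightarrow> ('k \<Rightarrow> 'e) \<Rightarrow> bool" where
  "diff_extension D R d \<iota> \<longleftrightarrow>
     Ring.field R \<and>
     (\<forall>i. \<forall>a\<in>carrier R. d i a \<in> carrier R) \<and>
     (\<forall>i. \<forall>a\<in>carrier R. \<forall>b\<in>carrier R. d i (a \<oplus>\<^bsub>R\<^esub> b) = d i a \<oplus>\<^bsub>R\<^esub> d i b) \<and>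
     (\<forall>i. \<forall>a\<in>carrier R. \<forall>b\<in>carrier R.
        d i (a \<otimes>\<^bsub>R\<^esub> b) = d i a \<otimes>\<^bsub>R\<^esub> b \<oplus>\<^bsub>R\<^esub> a \<otimes>\<^bsub>R\<^esub> d i b) \<and>
     (\<forall>i j. \<forall>a\<in>carrier R. d i (d j a) = d j (d i a)) \<and>
     \<iota> \<in> Ring.ring_hom class_ring R \<and>
     (\<forall>i a. d i (\<iota> a) = \<iota> (D i a))"

text \<open>
  Differential polynomials over \<open>'k\<close> in the unknowns \<open>Unk 0, Unk 1, \<dots>\<close>, given by expressions;
  only their values matter below, so no normal form is needed.
\<close>

datatype ('k, 'i) dpoly =
    Coeff 'k
  | Unk nat
  | Add "('k, 'i) dpoly" "('k, 'i) dpoly"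
  | Mul "('k, 'i) dpoly" "('k, 'i) dpoly"
  | Der 'i "('k, 'i) dpoly"

primrec dp_eval ::
  "'e ring \<Rightarrow> ('i \<Rightarrow> 'e \<Rightarrow> 'e) \<Rightarrow> ('k \<Rightarrow> 'e) \<Rightarrow> (nat \<Rightarrow> 'e) \<Rightarrow> ('k, 'i) dpoly \<Rightarrow> 'e" where
  "dp_eval R d \<iota> u (Coeff a) = \<iota> a"
| "dp_eval R d \<iota> u (Unk j) = u j"
| "dp_eval R d \<iota> u (Add p q) = dp_eval R d \<iota> u p \<oplus>\<^bsub>R\<^esub> dp_eval R d \<iota> u q"
| "dp_eval R d \<iota> u (Mul p q) = dp_eval R d \<iota> u p \<otimes>\<^bsub>R\<^esub> dp_eval R d \<iota> u q"
| "dp_eval R d \<iota> u (Der i p) = d i (dp_eval R d \<iota> u p)"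

definition solvable_in ::
  "'e ring \<Rightarrow> ('i \<Rightarrow> 'e \<Rightarrow> 'e) \<Rightarrow> ('k \<Rightarrow> 'e) \<Rightarrow> ('k, 'i) dpoly set \<Rightarrow> ('k, 'i) dpoly \<Rightarrow> bool" where
  "solvable_in R d \<iota> P q \<longleftrightarrow>
     (\<exists>u. (\<forall>j. u j \<in> carrier R) \<and>
          (\<forall>p\<in>P. dp_eval R d \<iota> u p = \<zero>\<^bsub>R\<^esub>) \<and> dp_eval R d \<iota> u q \<noteq> \<zero>\<^bsub>R\<^esub>)"

text \<open>
  Every finite system of differential equations \<open>p = 0\<close> (\<open>p \<in> P\<close>) and one inequation \<open>q \<noteq> 0\<close>
  that is solvable in some differential field extension is solvable in the field itself.
  HOL cannot quantify over the type carrying the extension, and the type \<open>nat \<Rightarrow> 'k\<close> is no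
  restriction: a system solvable in some extension is solvable in one that is finitely generated
  as a differential field, and such an extension has the same cardinality as the (infinite)
  field \<open>'k\<close>, hence an isomorphic copy with carrier in \<open>nat \<Rightarrow> 'k\<close>.
\<close>

definition differentially_closed :: "('i::finite \<Rightarrow> 'k \<Rightarrow> 'k::field_char_0) \<Rightarrow> bool" where
  "differentially_closed D \<longleftrightarrow>
     (\<forall>P q. finite P \<longrightarrow>
        (\<exists>(R :: (nat \<Rightarrow> 'k) ring) d \<iota>. diff_extension D R d \<iota> \<and> solvable_in R d \<iota> P q) \<longrightarrow>
        solvable_in class_ring D id P q)"

text \<open>Homogeneous linear differential expressions in the single unknown \<open>Unk 0\<close>.\<close>

inductive linear_dpoly :: "('k, 'i) dpoly \<Rightarrow> bool" where
  "linear_dpoly (Unk 0)"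
| "linear_dpoly p \<Longrightarrow> linear_dpoly q \<Longrightarrow> linear_dpoly (Add p q)"
| "linear_dpoly p \<Longrightarrow> linear_dpoly (Mul (Coeff a) p)"
| "linear_dpoly p \<Longrightarrow> linear_dpoly (Der i p)"

text \<open>
  The weaker alternative to differential closedness: the field contains a nonzero solution of
  every finite system of homogeneous linear partial differential equations for one unknown
  function that has a nonzero solution in some differential field extension.
\<close>

definition contains_solutions :: "('i::finite \<Rightarrow> 'k \<Rightarrow> 'k::field_char_0) \<Rightarrow> bool" where
  "contains_solutions D \<longleftrightarrow>
     (\<forall>P. finite P \<longrightarrow> (\<forall>p\<in>P. linear_dpoly p) \<longrightarrow>
        (\<exists>(R :: (nat \<Rightarrow> 'k) ring) d \<iota>. diff_extension D R d \<iota> \<and> solvable_in R d \<iota> P (Unk 0)) \<longrightarrow>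
        solvable_in class_ring D id P (Unk 0))"

text \<open>
  The operator \<open>\<Sum>\<^sub>\<alpha> a\<^sub>\<alpha> \<partial>\<^sup>\<alpha>\<close> is represented by its family of coefficients, indexed by the
  multi-indices \<open>\<alpha> :: 'i \<Rightarrow> nat\<close>. Only the additive structure of \<open>\<Rightarrow>\<^sub>0\<close> is used; the product of
  operators is \<open>op_mult\<close>.
\<close>

type_synonym ('i, 'k) lpdo = "('i \<Rightarrow> nat) \<Rightarrow>\<^sub>0 'k"

definition func_op :: "'k::zero \<Rightarrow> ('i, 'k) lpdo" where
  "func_op a = Poly_Mapping.single (\<lambda>_. 0) a"

definition deriv_op :: "'i \<Rightarrow> ('i, 'k::zero_neq_one) lpdo" where
  "deriv_op i = Poly_Mapping.single ((\<lambda>_. 0)(i := 1)) 1"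

text \<open>The iterated derivative \<open>\<partial>\<^sup>\<alpha> a\<close>; the fold is well defined because derivations commute.\<close>

definition mderiv :: "('i::finite \<Rightarrow> 'k \<Rightarrow> 'k) \<Rightarrow> ('i \<Rightarrow> nat) \<Rightarrow> 'k \<Rightarrow> 'k" where
  "mderiv D \<alpha> a = Finite_Set.fold (\<lambda>i. D i ^^ \<alpha> i) a UNIV"

definition op_apply ::
  "('i::finite \<Rightarrow> 'k \<Rightarrow> 'k::field_char_0) \<Rightarrow> ('i, 'k) lpdo \<Rightarrow> 'k \<Rightarrow> 'k" where
  "op_apply D P a = (\<Sum>\<alpha>\<in>Poly_Mapping.keys P. Poly_Mapping.lookup P \<alpha> * mderiv D \<alpha> a)"

definition op_ker ::
  "('i::finite \<Rightarrow> 'k \<Rightarrow> 'k::field_char_0) \<Rightarrow> ('i, 'k) lpdo \<Rightarrow> 'k set" where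
  "op_ker D P = {a. op_apply D P a = 0}"

text \<open>
  Leibniz formula:
  \<open>(a \<partial>\<^sup>\<alpha>) (b \<partial>\<^sup>\<beta>) = \<Sum>\<^sub>\<gamma> (\<alpha> choose \<gamma>) a (\<partial>\<^sup>\<gamma> b) \<partial>\<^sup>\<delta>\<close> with \<open>\<gamma> \<le> \<alpha>\<close> and \<open>\<delta> = \<alpha> - \<gamma> + \<beta>\<close>.
\<close>

definition op_mult ::
  "('i::finite \<Rightarrow> 'k \<Rightarrow> 'k::field_char_0) \<Rightarrow> ('i, 'k) lpdo \<Rightarrow> ('i, 'k) lpdo \<Rightarrow> ('i, 'k) lpdo" where
  "op_mult D P Q =
     (\<Sum>\<alpha>\<in>Poly_Mapping.keys P. \<Sum>\<beta>\<in>Poly_Mapping.keys Q. \<Sum>\<gamma>\<in>{\<gamma>. \<gamma> \<le> \<alpha>}.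
        Poly_Mapping.single (\<lambda>i. \<alpha> i - \<gamma> i + \<beta> i)
          (of_nat (\<Prod>i\<in>UNIV. \<alpha> i choose \<gamma> i) * Poly_Mapping.lookup P \<alpha>
             * mderiv D \<gamma> (Poly_Mapping.lookup Q \<beta>)))"

definition mdeg :: "('i::finite \<Rightarrow> nat) \<Rightarrow> nat" where
  "mdeg \<alpha> = (\<Sum>i\<in>UNIV. \<alpha> i)"

text \<open>The zero operator is given order \<open>0\<close>.\<close>

definition op_order :: "('i::finite, 'k::zero) lpdo \<Rightarrow> nat" where
  "op_order P = Max (insert 0 (mdeg ` Poly_Mapping.keys P))"

text \<open>
  The principal symbol, with the monomials of the polynomial ring in the symbols of the
  derivations again written as multi-indices.
\<close>

definition op_symbol :: "('i::finite, 'k::comm_monoid_add) lpdo \<Rightarrow> (('i \<Rightarrow> nat) \<Rightarrow>\<^sub>0 'k)" where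
  "op_symbol P =
     (\<Sum>\<alpha>\<in>{\<alpha> \<in> Poly_Mapping.keys P. mdeg \<alpha> = op_order P}.
        Poly_Mapping.single \<alpha> (Poly_Mapping.lookup P \<alpha>))"

definition darboux ::
  "('i::finite \<Rightarrow> 'k \<Rightarrow> 'k::field_char_0) \<Rightarrow> ('i, 'k) lpdo \<Rightarrow> ('i, 'k) lpdo
     \<Rightarrow> ('i, 'k) lpdo \<Rightarrow> ('i, 'k) lpdo \<Rightarrow> bool" where
  "darboux D M N L L1 \<longleftrightarrow> op_symbol L = op_symbol L1 \<and> op_mult D N L = op_mult D L1 M"

definition darboux_order ::
  "('i::finite \<Rightarrow> 'k \<Rightarrow> 'k::field_char_0) \<Rightarrow> ('i, 'k) lpdo \<Rightarrow> ('i, 'k) lpdo \<Rightarrow> nat" where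
  "darboux_order D M L = (LEAST r. \<exists>A. op_order (M + op_mult D A L) = r)"

text \<open>\<open>conj_op D f M\<close> is \<open>M\<^sup>1\<^sup>/\<^sup>f = f M (1/f)\<close>.\<close>

definition conj_op ::
  "('i::finite \<Rightarrow> 'k \<Rightarrow> 'k::field_char_0) \<Rightarrow> 'k \<Rightarrow> ('i, 'k) lpdo \<Rightarrow> ('i, 'k) lpdo" where
  "conj_op D f M = op_mult D (func_op f) (op_mult D M (func_op (1 / f)))"

definition type_I ::
  "('i::finite \<Rightarrow> 'k \<Rightarrow> 'k::field_char_0) \<Rightarrow> ('i, 'k) lpdo \<Rightarrow> ('i, 'k) lpdo
     \<Rightarrow> ('i, 'k) lpdo \<Rightarrow> ('i, 'k) lpdo \<Rightarrow> bool" where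
  "type_I D M N L L1 \<longleftrightarrow>
     (\<exists>C f. f \<noteq> 0 \<and>
        L = op_mult D C M + func_op f \<and>
        N = conj_op D f M \<and>
        L1 = op_mult D (conj_op D f M) C + func_op f)"

text \<open>
  In an abstract differential field, passing to new independent variables means replacing the
  derivations by another commuting family that is related to the old one by an invertible
  matrix over the field (the inverse Jacobian matrix).
\<close>

definition change_of_variables ::
  "('i::finite \<Rightarrow> 'k \<Rightarrow> 'k::field_char_0) \<Rightarrow> ('i \<Rightarrow> 'k \<Rightarrow> 'k) \<Rightarrow> bool" where
  "change_of_variables D D' \<longleftrightarrow>
     diff_field D' \<and>
     (\<exists>a b. (\<forall>i k. (\<Sum>j\<in>UNIV. a i j * b j k) = (if i = k then 1 else 0)) \<and>
            (\<forall>i k. (\<Sum>j\<in>UNIV. b i j * a j k) = (if i = k then 1 else 0)) \<and>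
            (\<forall>i g. D' i g = (\<Sum>j\<in>UNIV. a i j * D j g)))"

definition lin_indep ::
  "('i \<Rightarrow> 'k \<Rightarrow> 'k::field_char_0) \<Rightarrow> 'k list \<Rightarrow> bool" where
  "lin_indep D fs \<longleftrightarrow>
     (\<forall>c. (\<forall>j<length fs. c j \<in> constants D) \<longrightarrow> (\<Sum>j<length fs. c j * fs ! j) = 0 \<longrightarrow>
          (\<forall>j<length fs. c j = 0))"

definition wronskian :: "('k \<Rightarrow> 'k) \<Rightarrow> 'k list \<Rightarrow> 'k::field_char_0" where
  "wronskian d fs = det (mat (length fs) (length fs) (\<lambda>(r, j). (d ^^ r) (fs ! j)))"

text \<open>
  Being linearly independent over the constants of all derivations does not force the Wronskian
  with respect to a single variable to be nonzero, so this is required separately: it is the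
  denominator in the formula for \<open>M\<close>.
\<close>

definition wronskian_type ::
  "('i::finite \<Rightarrow> 'k \<Rightarrow> 'k::field_char_0) \<Rightarrow> ('i, 'k) lpdo \<Rightarrow> ('i, 'k) lpdo \<Rightarrow> bool" where
  "wronskian_type D M L \<longleftrightarrow>
     (\<exists>D' i fs. change_of_variables D D' \<and>
        fs \<noteq> [] \<and> set fs \<subseteq> op_ker D L \<and> lin_indep D fs \<and>
        wronskian (D' i) fs \<noteq> 0 \<and>
        (\<forall>g. op_apply D M g = wronskian (D' i) (fs @ [g]) / wronskian (D' i) fs))"

end

theory Submission
  imports Defs "HOL-Library.Function_Algebras" "HOL-Library.Countable"
    "HOL-Computational_Algebra.Fraction_Field" "HOL-Algebra.Weak_Morphisms"
begin

text \<open>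
  Let \<open>M = \<partial>\<^sub>t + m\<close> and \<open>N L = L\<^sub>1 M\<close>. Everything depends on whether the equations \<open>M\<psi> = 0\<close> and
  \<open>L\<psi> = 0\<close> are compatible, that is, on whether the left ideal \<open>J\<close> generated by \<open>M\<close> and \<open>L\<close>
  contains \<open>1\<close>.

  If it does not, the equations have a common solution \<open>\<psi> \<noteq> 0\<close> in the field
  (\<open>linear_nullstellensatz\<close>), and \<open>M\<psi> = 0\<close> means \<open>M = \<partial>\<^sub>t - \<psi>\<^sub>t / \<psi>\<close>, the Wronskian type. To
  find \<open>\<psi>\<close>, embed the field \<open>K\<close> into the ring \<open>K[[X]]\<close> of power series by Taylor expansion
  \<open>a \<mapsto> \<Sum>\<^sub>\<alpha> (\<partial>\<^sup>\<alpha> a) X\<^sup>\<alpha> / \<alpha>!\<close>, which turns the given derivations into those with respect to the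
  variables \<open>X\<^sub>i\<close>. A \<open>K\<close>-linear functional \<open>\<phi>\<close> on operators with \<open>\<phi>(J) = 0\<close> and \<open>\<phi>(1) = 1\<close> exists
  because \<open>1\<close> is not in \<open>J\<close>, and \<open>\<Sum>\<^sub>\<alpha> \<phi>(\<partial>\<^sup>\<alpha>) X\<^sup>\<alpha> / \<alpha>!\<close> is a solution with constant term \<open>1\<close>
  (\<open>formal_solution\<close>). So there is a solution in the fraction field of \<open>K[[X]]\<close>, hence in \<open>K\<close> by
  the closure hypothesis.

  If \<open>1\<close> is in \<open>J\<close>, then \<open>L \<noteq> 0\<close>, as nonzero multiples of \<open>M\<close> involve \<open>\<partial>\<^sub>t\<close>. Divide: \<open>L = C M + B\<close> with \<open>B\<close> free of \<open>\<partial>\<^sub>t\<close>. Equality of the principal symbols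
  of \<open>L\<close> and \<open>L\<^sub>1\<close> forces \<open>N = \<partial>\<^sub>t + n\<close> (\<open>intertwiner_first_order\<close>), and comparing remainders
  turns \<open>N L = L\<^sub>1 M\<close> into \<open>N B = B M\<close> and \<open>L\<^sub>1 = N C + B\<close> (\<open>intertwining_of_remainder\<close>). Reducing
  a relation \<open>1 = A M + E L\<close> modulo \<open>M\<close> leaves \<open>1 = R B\<close>, so \<open>B\<close> is a nonzero function \<open>f\<close>, and
  \<open>L = C M + f\<close>, \<open>N = f M (1/f)\<close>, \<open>L\<^sub>1 = N C + f\<close> is a transformation of Type I
  (\<open>type_I_of_unit_ideal\<close>).

  The algebra of operators rests on two facts: they act on every differential module
  (\<open>act_op_mult\<close>), and degrees add under composition (\<open>exists_top_key\<close>).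
\<close>

section \<open>Multi-indices\<close>

definition unit_index :: "'i \<Rightarrow> 'i \<Rightarrow> nat" where
  "unit_index i = (\<lambda>_. 0)(i := 1)"

lemma unit_index_apply: "unit_index i j = (if j = i then 1 else 0)"
  by (simp add: unit_index_def)

lemma mdeg_add: "mdeg (\<alpha> + \<beta>) = mdeg \<alpha> + mdeg \<beta>"
  by (simp add: mdeg_def sum.distrib)

lemma mdeg_unit_index [simp]: "mdeg (unit_index i :: 'i::finite \<Rightarrow> nat) = 1"
  by (simp add: mdeg_def unit_index_apply)

lemma mdeg_eq_0_iff: "mdeg \<alpha> = 0 \<longleftrightarrow> \<alpha> = 0"
  by (auto simp: mdeg_def fun_eq_iff)

lemma multi_index_induct [case_names zero add_unit]:
  fixes \<alpha> :: "'i::finite \<Rightarrow> nat"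
  assumes zero: "P 0" and add_unit: "\<And>\<alpha> i. P \<alpha> \<Longrightarrow> P (\<alpha> + unit_index i)"
  shows "P \<alpha>"
proof (induction "mdeg \<alpha>" arbitrary: \<alpha>)
  case 0
  then have "\<alpha> = 0" by (simp add: mdeg_eq_0_iff)
  then show "P \<alpha>" using zero by simp
next
  case (Suc n)
  then have "\<alpha> \<noteq> 0" by (auto simp: mdeg_def)
  then obtain i where i: "\<alpha> i > 0" by (auto simp: fun_eq_iff)
  have \<alpha>: "\<alpha> = (\<alpha> - unit_index i) + unit_index i"
    using i by (auto simp: fun_eq_iff unit_index_apply)
  then have "mdeg \<alpha> = mdeg (\<alpha> - unit_index i) + 1"
    by (metis mdeg_add mdeg_unit_index)
  then have "P (\<alpha> - unit_index i)" using Suc by simp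
  then show ?case using add_unit \<alpha> by metis
qed

lemma add_unit_minus: "\<alpha> + unit_index i - unit_index i = \<alpha>"
  by (simp add: fun_eq_iff)

lemma minus_unit_add: "\<alpha> i > 0 \<Longrightarrow> \<alpha> - unit_index i + unit_index i = \<alpha>"
  by (auto simp: fun_eq_iff unit_index_apply)

lemma finite_multi_index_le: "finite {\<gamma>. \<gamma> \<le> (\<alpha> :: 'i::finite \<Rightarrow> nat)}"
proof -
  have "{\<gamma>. \<gamma> \<le> \<alpha>} = PiE UNIV (\<lambda>i. {..\<alpha> i})"
    by (auto simp: le_fun_def PiE_UNIV_domain)
  then show ?thesis by (simp add: finite_PiE)
qed

text \<open>
  Refine both sets coordinate by coordinate to the exponents with minimal entry, as for a
  lexicographic order; one exponent of each set is left, and their sum arises in no other way. This keeps the lowest terms of a product of power series, and the highest terms of a product of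
  operators, from cancelling.
\<close>

lemma exists_unique_sum:
  fixes A B :: "('i::finite \<Rightarrow> nat) set"
  assumes "A \<noteq> {}" "B \<noteq> {}"
  shows "\<exists>\<beta>\<in>A. \<exists>\<gamma>\<in>B. \<forall>\<beta>'\<in>A. \<forall>\<gamma>'\<in>B. \<beta>' + \<gamma>' = \<beta> + \<gamma> \<longrightarrow> \<beta>' = \<beta> \<and> \<gamma>' = \<gamma>"
proof -
  have "\<exists>\<beta>\<in>A. \<exists>\<gamma>\<in>B. \<forall>\<beta>'\<in>A. \<forall>\<gamma>'\<in>B.
          (\<forall>i\<in>S. \<beta>' i + \<gamma>' i = \<beta> i + \<gamma> i) \<longrightarrow> (\<forall>i\<in>S. \<beta>' i = \<beta> i \<and> \<gamma>' i = \<gamma> i)"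
    if "finite S" for S :: "'i set"
    using that assms
  proof (induction S arbitrary: A B rule: finite_induct)
    case empty
    then show ?case by auto
  next
    case (insert i S)
    define a where "a = (LEAST n. n \<in> (\<lambda>\<alpha>. \<alpha> i) ` A)"
    define b where "b = (LEAST n. n \<in> (\<lambda>\<alpha>. \<alpha> i) ` B)"
    have a: "a \<in> (\<lambda>\<alpha>. \<alpha> i) ` A" "\<And>\<alpha>. \<alpha> \<in> A \<Longrightarrow> a \<le> \<alpha> i"
      unfolding a_def using insert.prems by (auto intro: LeastI_ex Least_le)
    have b: "b \<in> (\<lambda>\<alpha>. \<alpha> i) ` B" "\<And>\<alpha>. \<alpha> \<in> B \<Longrightarrow> b \<le> \<alpha> i"
      unfolding b_def using insert.prems by (auto intro: LeastI_ex Least_le)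
    let ?A = "{\<alpha> \<in> A. \<alpha> i = a}" and ?B = "{\<alpha> \<in> B. \<alpha> i = b}"
    have "?A \<noteq> {}" "?B \<noteq> {}" using a(1) b(1) by auto
    from insert.IH[OF this] obtain \<beta> \<gamma> where \<beta>: "\<beta> \<in> ?A" and \<gamma>: "\<gamma> \<in> ?B"
      and *: "\<forall>\<beta>'\<in>?A. \<forall>\<gamma>'\<in>?B. (\<forall>i\<in>S. \<beta>' i + \<gamma>' i = \<beta> i + \<gamma> i)
          \<longrightarrow> (\<forall>i\<in>S. \<beta>' i = \<beta> i \<and> \<gamma>' i = \<gamma> i)"
      by (elim bexE)
    have "\<forall>j\<in>insert i S. \<beta>' j = \<beta> j \<and> \<gamma>' j = \<gamma> j"
      if "\<beta>' \<in> A" "\<gamma>' \<in> B" and eq: "\<forall>j\<in>insert i S. \<beta>' j + \<gamma>' j = \<beta> j + \<gamma> j" for \<beta>' \<gamma>'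
    proof -
      have i: "\<beta> i = a" "\<gamma> i = b" using \<beta> \<gamma> by simp_all
      have "\<beta>' i + \<gamma>' i = \<beta> i + \<gamma> i" using eq by blast
      moreover have "a \<le> \<beta>' i" "b \<le> \<gamma>' i" using a b that(1,2) by blast+
      ultimately have i': "\<beta>' i = a" "\<gamma>' i = b" using i by linarith+
      then have "\<beta>' \<in> ?A" "\<gamma>' \<in> ?B" using that(1,2) by simp_all
      then have "\<forall>j\<in>S. \<beta>' j = \<beta> j \<and> \<gamma>' j = \<gamma> j" using * eq by blast
      then show ?thesis using i i' by blast
    qed
    moreover have "\<beta> \<in> A" "\<gamma> \<in> B" using \<beta> \<gamma> by simp_all
    ultimately show ?case by blast
  qed
  from this[OF finite_class.finite_UNIV] show ?thesis
    by (simp add: fun_eq_iff all_conj_distrib)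
qed

section \<open>Iterated derivatives and the Leibniz formula\<close>

lemma mderiv_0:
  fixes d :: "'i::finite \<Rightarrow> 'v \<Rightarrow> 'v"
  shows "mderiv d 0 v = v"
proof -
  have "Finite_Set.fold (\<lambda>i v. v) v S = v" if "finite S" for S :: "'i set" and v :: 'v
  proof -
    interpret comp_fun_commute "\<lambda>(i :: 'i) (v :: 'v). v"
      by unfold_locales auto
    show ?thesis using that by (induction S rule: finite_induct) auto
  qed
  moreover have "(\<lambda>i. d i ^^ (0 :: 'i \<Rightarrow> nat) i) = (\<lambda>i v. v)"
    by (simp add: fun_eq_iff)
  ultimately show ?thesis by (simp add: mderiv_def)
qed

locale commuting_maps =
  fixes d :: "'i::finite \<Rightarrow> 'v \<Rightarrow> 'v"
  assumes commute: "d i (d j v) = d j (d i v)"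
begin

lemma funpow_commute: "(d i ^^ m) ((d j ^^ n) v) = (d j ^^ n) ((d i ^^ m) v)"
proof -
  have *: "d i ((d j ^^ n) v) = (d j ^^ n) (d i v)" for v
  proof (induction n)
    case (Suc n)
    have "d i (d j ((d j ^^ n) v)) = d j (d i ((d j ^^ n) v))" by (rule commute)
    then show ?case using Suc by simp
  qed simp
  show ?thesis by (induction m arbitrary: v) (simp_all add: *)
qed

lemma mderiv_add_unit: "mderiv d (\<alpha> + unit_index i) v = d i (mderiv d \<alpha> v)"
proof -
  have fc: "comp_fun_commute (\<lambda>j. d j ^^ (\<beta> j))" for \<beta> :: "'i \<Rightarrow> nat"
    by unfold_locales (auto simp: fun_eq_iff funpow_commute)
  have split: "mderiv d \<beta> v = (d i ^^ \<beta> i) (Finite_Set.fold (\<lambda>j. d j ^^ (\<beta> j)) v (UNIV - {i}))"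
    for \<beta> :: "'i \<Rightarrow> nat"
  proof -
    interpret comp_fun_commute "\<lambda>j. d j ^^ (\<beta> j)" by (rule fc)
    show ?thesis unfolding mderiv_def by (rule fold_rec) auto
  qed
  have "Finite_Set.fold (\<lambda>j. d j ^^ ((\<alpha> + unit_index i) j)) v (UNIV - {i})
      = Finite_Set.fold (\<lambda>j. d j ^^ (\<alpha> j)) v (UNIV - {i})"
    using fc[of \<alpha>] fc[of "\<alpha> + unit_index i"]
    by (intro Finite_Set.fold_cong[of UNIV]) (auto simp: comp_fun_commute_def' unit_index_apply)
  then show ?thesis
    unfolding split[of "\<alpha> + unit_index i"] split[of \<alpha>] by (simp add: unit_index_apply)
qed

lemma mderiv_unit: "mderiv d (unit_index i) v = d i v"
  using mderiv_add_unit[of 0 i v] by (simp add: mderiv_0)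

lemma mderiv_commute: "mderiv d \<alpha> (d i v) = d i (mderiv d \<alpha> v)"
proof (induction \<alpha> rule: multi_index_induct)
  case zero
  show "mderiv d 0 (d i v) = d i (mderiv d 0 v)" by (simp add: mderiv_0)
next
  case (add_unit \<alpha> j)
  then show "mderiv d (\<alpha> + unit_index j) (d i v) = d i (mderiv d (\<alpha> + unit_index j) v)"
    by (simp add: mderiv_add_unit commute[of i j])
qed

end

definition splits :: "('i \<Rightarrow> nat) \<Rightarrow> (('i \<Rightarrow> nat) \<times> ('i \<Rightarrow> nat)) set" where
  "splits \<alpha> = {(\<beta>, \<gamma>). \<beta> + \<gamma> = \<alpha>}"

lemma splits_eq_image: "splits \<alpha> = (\<lambda>\<gamma>. (\<gamma>, \<alpha> - \<gamma>)) ` {\<gamma>. \<gamma> \<le> \<alpha>}"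
proof -
  have "\<gamma> + (\<alpha> - \<gamma>) = \<alpha>" if "\<gamma> \<le> \<alpha>" for \<gamma>
    using that by (simp add: le_fun_def fun_eq_iff)
  moreover have "\<beta> \<le> \<beta> + \<gamma>" "\<gamma> = \<beta> + \<gamma> - \<beta>" for \<beta> \<gamma> :: "'a \<Rightarrow> nat"
    by (simp_all add: le_fun_def fun_eq_iff)
  ultimately show ?thesis unfolding splits_def by blast
qed

lemma finite_splits [simp]: "finite (splits (\<alpha> :: 'i::finite \<Rightarrow> nat))"
  by (simp add: splits_eq_image finite_multi_index_le)

lemma splits_0 [simp]: "splits 0 = {(0, 0)}"
  by (auto simp: splits_def fun_eq_iff)

lemma sum_splits_eq_sum_le:
  "(\<Sum>(\<beta>, \<gamma>)\<in>splits \<alpha>. h \<beta> \<gamma>) = (\<Sum>\<gamma>\<in>{\<gamma>. \<gamma> \<le> \<alpha>}. h \<gamma> (\<alpha> - \<gamma>))"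
  unfolding splits_eq_image by (subst sum.reindex) (auto simp: inj_on_def)

lemma sum_splits_swap: "(\<Sum>(\<beta>, \<gamma>)\<in>splits \<alpha>. h \<beta> \<gamma>) = (\<Sum>(\<beta>, \<gamma>)\<in>splits \<alpha>. h \<gamma> \<beta>)"
  by (rule sum.reindex_bij_witness[of _ prod.swap prod.swap])
    (auto simp: splits_def add.commute)

text \<open>
  The splittings of \<open>\<alpha> + e\<^sub>i\<close> with first part positive at \<open>i\<close> correspond to the splittings of
  \<open>\<alpha>\<close>. This reindexing is behind the product rules below.
\<close>

lemma sum_splits_add_unit:
  fixes h :: "('i::finite \<Rightarrow> nat) \<Rightarrow> ('i \<Rightarrow> nat) \<Rightarrow> 'v::comm_monoid_add"
  assumes "\<And>\<beta> \<gamma>. \<beta> i = 0 \<Longrightarrow> h \<beta> \<gamma> = 0"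
  shows "(\<Sum>(\<beta>, \<gamma>)\<in>splits (\<alpha> + unit_index i). h \<beta> \<gamma>) = (\<Sum>(\<beta>, \<gamma>)\<in>splits \<alpha>. h (\<beta> + unit_index i) \<gamma>)"
proof -
  have "(\<Sum>(\<beta>, \<gamma>)\<in>splits (\<alpha> + unit_index i). h \<beta> \<gamma>)
      = (\<Sum>(\<beta>, \<gamma>)\<in>{p \<in> splits (\<alpha> + unit_index i). fst p i \<noteq> 0}. h \<beta> \<gamma>)"
    by (rule sum.mono_neutral_right) (auto simp: assms intro!: gr0I)
  also have "\<dots> = (\<Sum>(\<beta>, \<gamma>)\<in>splits \<alpha>. h (\<beta> + unit_index i) \<gamma>)"
  proof -
    have "\<beta> - unit_index i + \<gamma> = \<alpha>" if "\<beta> + \<gamma> = \<alpha> + unit_index i" "\<beta> i > 0" for \<beta> \<gamma>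
    proof -
      have "\<beta> - unit_index i + \<gamma> + unit_index i = \<alpha> + unit_index i"
        using that minus_unit_add[of \<beta> i] by (metis add.assoc add.commute)
      then show ?thesis by (rule add_right_imp_eq)
    qed
    moreover have "\<beta> + unit_index i + \<gamma> = \<alpha> + unit_index i" if "\<beta> + \<gamma> = \<alpha>" for \<beta> \<gamma>
      using that by (metis add.assoc add.commute)
    ultimately show ?thesis
    by (intro sum.reindex_bij_witness[of _ "\<lambda>(\<beta>, \<gamma>). (\<beta> + unit_index i, \<gamma>)"
          "\<lambda>(\<beta>, \<gamma>). (\<beta> - unit_index i, \<gamma>)"])
      (auto simp: splits_def add_unit_minus minus_unit_add unit_index_apply)
  qed
  finally show ?thesis .
qed

definition mfact :: "('i::finite \<Rightarrow> nat) \<Rightarrow> 'k::field_char_0" where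
  "mfact \<alpha> = (\<Prod>i\<in>UNIV. fact (\<alpha> i))"

lemma mfact_nonzero [simp]: "mfact \<alpha> \<noteq> 0"
  by (simp add: mfact_def)

lemma mfact_0 [simp]: "mfact 0 = 1"
  by (simp add: mfact_def)

lemma mfact_add_unit: "mfact (\<alpha> + unit_index i) = of_nat (Suc (\<alpha> i)) * mfact \<alpha>"
proof -
  have "mfact \<beta> = fact (\<beta> i) * (\<Prod>j\<in>UNIV - {i}. fact (\<beta> j))" for \<beta> :: "'b \<Rightarrow> nat"
    unfolding mfact_def by (rule prod.remove) auto
  note * = this
  show ?thesis
    unfolding *[of "\<alpha> + unit_index i"] *[of \<alpha>] by (simp add: unit_index_apply)
qed

lemma mfact_quotient_eq_prod_binomial:
  assumes "\<gamma> \<le> \<alpha>"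
  shows "mfact \<alpha> / (mfact \<gamma> * mfact (\<alpha> - \<gamma>)) = of_nat (\<Prod>i\<in>UNIV. \<alpha> i choose \<gamma> i)"
proof -
  have "(of_nat (\<alpha> i choose \<gamma> i) :: 'b) = fact (\<alpha> i) / (fact (\<gamma> i) * fact ((\<alpha> - \<gamma>) i))" for i
    using assms by (simp add: binomial_fact le_fun_def)
  then show ?thesis by (simp add: mfact_def prod_dividef prod.distrib)
qed

text \<open>
  A vector space over a differential field with derivations compatible with those of the field.
  The field itself, the operators (with left multiplication by the \<open>\<partial>\<^sub>i\<close>), the formal power series and
  the differential extensions are all of this kind, and an operator acts on each of them.
\<close>

locale diff_module =
  fixes D :: "'i::finite \<Rightarrow> 'k::field_char_0 \<Rightarrow> 'k"
    and scale :: "'k \<Rightarrow> 'v::ab_group_add \<Rightarrow> 'v"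
    and d :: "'i \<Rightarrow> 'v \<Rightarrow> 'v"
  assumes diff_field: "diff_field D"
    and scale_add_right: "scale a (u + v) = scale a u + scale a v"
    and scale_add_left: "scale (a + b) v = scale a v + scale b v"
    and scale_scale: "scale a (scale b v) = scale (a * b) v"
    and scale_one: "scale 1 v = v"
    and d_add: "d i (u + v) = d i u + d i v"
    and d_scale: "d i (scale a v) = scale (D i a) v + scale a (d i v)"
    and d_commute: "d i (d j v) = d j (d i v)"
begin

sublocale D: commuting_maps D
  using diff_field by unfold_locales (simp add: diff_field_def)

sublocale d: commuting_maps d
  by unfold_locales (rule d_commute)

lemma scale_zero_left [simp]: "scale 0 v = 0"
  using scale_add_left[of 0 0 v] by simp

lemma scale_zero_right [simp]: "scale a 0 = 0"
  using scale_add_right[of a 0 0] by simp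

lemma scale_sum: "scale a (sum f A) = (\<Sum>x\<in>A. scale a (f x))"
  by (induction A rule: infinite_finite_induct) (auto simp: scale_add_right)

lemma mderiv_module_add: "mderiv d \<alpha> (u + v) = mderiv d \<alpha> u + mderiv d \<alpha> v"
proof (induction \<alpha> rule: multi_index_induct)
  case zero
  show "mderiv d 0 (u + v) = mderiv d 0 u + mderiv d 0 v" by (simp add: mderiv_0)
next
  case (add_unit \<alpha> i)
  then show "mderiv d (\<alpha> + unit_index i) (u + v)
      = mderiv d (\<alpha> + unit_index i) u + mderiv d (\<alpha> + unit_index i) v"
    by (simp add: d.mderiv_add_unit d_add)
qed

lemma mderiv_module_zero [simp]: "mderiv d \<alpha> 0 = 0"
  using mderiv_module_add[of \<alpha> 0 0] by simp

lemma mderiv_module_sum: "mderiv d \<alpha> (sum f A) = (\<Sum>x\<in>A. mderiv d \<alpha> (f x))"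
  by (induction A rule: infinite_finite_induct) (auto simp: mderiv_module_add)

text \<open>
  With divided powers no binomial coefficients appear, and the induction step is only
  \<open>\<alpha>\<^sub>i + 1 = \<beta>\<^sub>i + \<gamma>\<^sub>i\<close> for \<open>\<beta> + \<gamma> = \<alpha> + e\<^sub>i\<close>: the part weighted by \<open>\<beta>\<^sub>i\<close> comes from
  differentiating the scalar, the part weighted by \<open>\<gamma>\<^sub>i\<close> from differentiating the vector.
\<close>

theorem leibniz:
  "scale (1 / mfact \<alpha>) (mderiv d \<alpha> (scale a v))
     = (\<Sum>(\<beta>, \<gamma>)\<in>splits \<alpha>. scale (mderiv D \<beta> a / (mfact \<beta> * mfact \<gamma>)) (mderiv d \<gamma> v))"
proof (induction \<alpha> arbitrary: a v rule: multi_index_induct)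
  case zero
  show "scale (1 / mfact 0) (mderiv d 0 (scale a v))
      = (\<Sum>(\<beta>, \<gamma>)\<in>splits 0. scale (mderiv D \<beta> a / (mfact \<beta> * mfact \<gamma>)) (mderiv d \<gamma> v))"
    by (simp add: mderiv_0 scale_one)
next
  case (add_unit \<alpha> i)
  let ?e = "unit_index i"
  let ?n = "of_nat (Suc (\<alpha> i)) :: 'k"
  let ?T = "\<lambda>\<beta> \<gamma>. scale (mderiv D \<beta> a / (mfact \<beta> * mfact \<gamma>)) (mderiv d \<gamma> v)"
  have n: "?n \<noteq> 0" by (rule of_nat_neq_0)
  have fst_part: "(\<Sum>(\<beta>, \<gamma>)\<in>splits (\<alpha> + ?e). scale (of_nat (\<beta> i)) (?T \<beta> \<gamma>))
      = scale (1 / mfact \<alpha>) (mderiv d \<alpha> (scale (D i a) v))"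
  proof -
    have "(\<Sum>(\<beta>, \<gamma>)\<in>splits (\<alpha> + ?e). scale (of_nat (\<beta> i)) (?T \<beta> \<gamma>))
        = (\<Sum>(\<beta>, \<gamma>)\<in>splits \<alpha>. scale (of_nat ((\<beta> + ?e) i)) (?T (\<beta> + ?e) \<gamma>))"
      by (rule sum_splits_add_unit) simp
    also have "\<dots> = (\<Sum>(\<beta>, \<gamma>)\<in>splits \<alpha>. scale (mderiv D \<beta> (D i a) / (mfact \<beta> * mfact \<gamma>)) (mderiv d \<gamma> v))"
      by (rule sum.cong[OF refl])
        (auto simp: scale_scale mfact_add_unit D.mderiv_add_unit D.mderiv_commute unit_index_apply
          simp del: of_nat_Suc)
    finally show ?thesis using add_unit.IH[of "D i a" v] by simp
  qed
  have snd_part: "(\<Sum>(\<beta>, \<gamma>)\<in>splits (\<alpha> + ?e). scale (of_nat (\<gamma> i)) (?T \<beta> \<gamma>))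
      = scale (1 / mfact \<alpha>) (mderiv d \<alpha> (scale a (d i v)))"
  proof -
    have "(\<Sum>(\<beta>, \<gamma>)\<in>splits (\<alpha> + ?e). scale (of_nat (\<gamma> i)) (?T \<beta> \<gamma>))
        = (\<Sum>(\<gamma>, \<beta>)\<in>splits (\<alpha> + ?e). scale (of_nat (\<gamma> i)) (?T \<beta> \<gamma>))"
      by (rule sum_splits_swap)
    also have "\<dots> = (\<Sum>(\<gamma>, \<beta>)\<in>splits \<alpha>. scale (of_nat ((\<gamma> + ?e) i)) (?T \<beta> (\<gamma> + ?e)))"
      by (rule sum_splits_add_unit) simp
    also have "\<dots> = (\<Sum>(\<gamma>, \<beta>)\<in>splits \<alpha>. scale (mderiv D \<beta> a / (mfact \<beta> * mfact \<gamma>)) (mderiv d \<gamma> (d i v)))"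
      by (rule sum.cong[OF refl])
        (auto simp: scale_scale mfact_add_unit d.mderiv_add_unit d.mderiv_commute unit_index_apply
          simp del: of_nat_Suc)
    also have "\<dots> = (\<Sum>(\<beta>, \<gamma>)\<in>splits \<alpha>. scale (mderiv D \<beta> a / (mfact \<beta> * mfact \<gamma>)) (mderiv d \<gamma> (d i v)))"
      by (rule sum_splits_swap)
    finally show ?thesis using add_unit.IH[of a "d i v"] by simp
  qed
  have "scale (1 / mfact (\<alpha> + ?e)) (mderiv d (\<alpha> + ?e) (scale a v))
      = scale (1 / ?n) (scale (1 / mfact \<alpha>) (mderiv d \<alpha> (d i (scale a v))))"
    by (simp add: scale_scale mfact_add_unit d.mderiv_add_unit d.mderiv_commute del: of_nat_Suc)
  also have "\<dots> = scale (1 / ?n) (\<Sum>(\<beta>, \<gamma>)\<in>splits (\<alpha> + ?e).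
      scale (of_nat (\<beta> i)) (?T \<beta> \<gamma>) + scale (of_nat (\<gamma> i)) (?T \<beta> \<gamma>))"
    using fst_part snd_part
    by (simp add: d_scale mderiv_module_add scale_add_right sum.distrib case_prod_unfold)
  also have "\<dots> = (\<Sum>(\<beta>, \<gamma>)\<in>splits (\<alpha> + ?e). ?T \<beta> \<gamma>)"
  proof -
    have "scale (1 / ?n) (scale (of_nat (\<beta> i)) (?T \<beta> \<gamma>) + scale (of_nat (\<gamma> i)) (?T \<beta> \<gamma>)) = ?T \<beta> \<gamma>"
      if "(\<beta>, \<gamma>) \<in> splits (\<alpha> + ?e)" for \<beta> \<gamma>
    proof -
      have "\<beta> + \<gamma> = \<alpha> + ?e" using that by (simp add: splits_def)
      then have "(\<beta> + \<gamma>) i = (\<alpha> + ?e) i" by (rule fun_cong)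
      then have "\<beta> i + \<gamma> i = Suc (\<alpha> i)" by (simp add: unit_index_apply)
      then have "of_nat (\<beta> i) + of_nat (\<gamma> i) = ?n" by (metis of_nat_add)
      then have "1 / ?n * ((of_nat (\<beta> i) + of_nat (\<gamma> i)) * c) = c" for c
        using n by simp
      then show ?thesis
        by (simp only: scale_add_left[symmetric] scale_scale distrib_right[symmetric])
    qed
    then show ?thesis
      unfolding scale_sum by (intro sum.cong) auto
  qed
  finally show ?case .
qed

lemma leibniz_binomial:
  "mderiv d \<alpha> (scale a v) = (\<Sum>\<gamma>\<in>{\<gamma>. \<gamma> \<le> \<alpha>}.
     scale (of_nat (\<Prod>i\<in>UNIV. \<alpha> i choose \<gamma> i) * mderiv D \<gamma> a) (mderiv d (\<alpha> - \<gamma>) v))"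
proof -
  have "mderiv d \<alpha> (scale a v) = scale (mfact \<alpha>) (scale (1 / mfact \<alpha>) (mderiv d \<alpha> (scale a v)))"
    by (simp add: scale_scale scale_one)
  also have "\<dots> = (\<Sum>\<gamma>\<in>{\<gamma>. \<gamma> \<le> \<alpha>}. scale (mfact \<alpha> * (mderiv D \<gamma> a / (mfact \<gamma> * mfact (\<alpha> - \<gamma>)))) (mderiv d (\<alpha> - \<gamma>) v))"
    unfolding leibniz sum_splits_eq_sum_le scale_sum scale_scale ..
  also have "\<dots> = (\<Sum>\<gamma>\<in>{\<gamma>. \<gamma> \<le> \<alpha>}.
     scale (of_nat (\<Prod>i\<in>UNIV. \<alpha> i choose \<gamma> i) * mderiv D \<gamma> a) (mderiv d (\<alpha> - \<gamma>) v))"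
    by (intro sum.cong refl) (simp add: mfact_quotient_eq_prod_binomial[symmetric] del: of_nat_prod)
  finally show ?thesis .
qed

definition act :: "('i, 'k) lpdo \<Rightarrow> 'v \<Rightarrow> 'v" where
  "act P v = (\<Sum>\<alpha>\<in>Poly_Mapping.keys P. scale (Poly_Mapping.lookup P \<alpha>) (mderiv d \<alpha> v))"

lemma act_single: "act (Poly_Mapping.single \<alpha> a) v = scale a (mderiv d \<alpha> v)"
  by (simp add: act_def)

lemma act_add_left: "act (P + Q) v = act P v + act Q v"
  unfolding act_def by (rule setsum_keys_plus_distrib) (simp_all add: scale_add_left)

lemma act_zero_left [simp]: "act 0 v = 0"
  by (simp add: act_def)

lemma act_sum_left: "act (sum f A) v = (\<Sum>x\<in>A. act (f x) v)"
  by (induction A rule: infinite_finite_induct) (simp_all add: act_add_left)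

lemma act_add_right: "act P (u + v) = act P u + act P v"
  by (simp add: act_def mderiv_module_add scale_add_right sum.distrib)

lemma act_func_op: "act (func_op a) v = scale a v"
  by (simp add: func_op_def act_single mderiv_0[unfolded zero_fun_def])

end

section \<open>The algebra of differential operators\<close>

lemma lpdo_induct [case_names single add]:
  assumes "\<And>\<alpha> a. P (Poly_Mapping.single \<alpha> a)" "\<And>p q. P p \<Longrightarrow> P q \<Longrightarrow> P (p + q)"
  shows "P (p :: 'b \<Rightarrow>\<^sub>0 'a::comm_monoid_add)"
proof -
  have eq: "p = (\<Sum>\<alpha>\<in>Poly_Mapping.keys p. Poly_Mapping.single \<alpha> (Poly_Mapping.lookup p \<alpha>))"
    by (rule poly_mapping_eqI) (simp add: lookup_sum lookup_single when_def in_keys_iff)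
  have "P (\<Sum>\<alpha>\<in>A. Poly_Mapping.single \<alpha> (f \<alpha>))" for f and A :: "'b set"
    by (induction A rule: infinite_finite_induct) (use assms(1)[of undefined 0] assms in auto)
  then show ?thesis by (subst eq)
qed

definition coeff_deriv ::
    "('i \<Rightarrow> 'k \<Rightarrow> 'k::field_char_0) \<Rightarrow> 'i \<Rightarrow> ('i, 'k) lpdo \<Rightarrow> ('i, 'k) lpdo" where
  "coeff_deriv D i P = Poly_Mapping.map (D i) P"

text \<open>
  Here \<open>*\<close> is the commutative product of finitely supported families, that is, the product of total
  symbols. It coincides with composition of operators when the left factor is a function.
\<close>

definition op_scale :: "'k::field_char_0 \<Rightarrow> ('i, 'k) lpdo \<Rightarrow> ('i, 'k) lpdo" where
  "op_scale a P = func_op a * P"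

text \<open>
  Left multiplication by \<open>\<partial>\<^sub>i\<close>, on total symbols:
  \<open>\<partial>\<^sub>i (a \<partial>\<^sup>\<beta>) = a \<partial>\<^sub>i \<partial>\<^sup>\<beta> + (\<partial>\<^sub>i a) \<partial>\<^sup>\<beta>\<close>.
\<close>

definition op_deriv ::
    "('i \<Rightarrow> 'k \<Rightarrow> 'k::field_char_0) \<Rightarrow> 'i \<Rightarrow> ('i, 'k) lpdo \<Rightarrow> ('i, 'k) lpdo" where
  "op_deriv D i P = deriv_op i * P + coeff_deriv D i P"

lemma deriv_op_eq: "deriv_op i = Poly_Mapping.single (unit_index i) 1"
  by (simp add: deriv_op_def unit_index_def)

lemma func_op_eq: "func_op a = Poly_Mapping.single 0 a"
  by (simp add: func_op_def zero_fun_def)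

context
  fixes D :: "'i::finite \<Rightarrow> 'k::field_char_0 \<Rightarrow> 'k"
  assumes df: "diff_field D"
begin

lemma D_add: "D i (a + b) = D i a + D i b"
  using df by (simp add: diff_field_def)

lemma D_mult: "D i (a * b) = D i a * b + a * D i b"
  using df by (simp add: diff_field_def)

lemma D_commute: "D i (D j a) = D j (D i a)"
  using df by (simp add: diff_field_def)

lemma D_0: "D i 0 = 0"
  using D_add[of i 0 0] by simp

lemma D_1: "D i 1 = 0"
  using D_mult[of i 1 1] by simp

lemma lookup_coeff_deriv: "Poly_Mapping.lookup (coeff_deriv D i P) \<alpha> = D i (Poly_Mapping.lookup P \<alpha>)"
  by (simp add: coeff_deriv_def map.rep_eq when_def D_0)

lemma coeff_deriv_single: "coeff_deriv D i (Poly_Mapping.single \<alpha> a) = Poly_Mapping.single \<alpha> (D i a)"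
  by (rule poly_mapping_eqI) (simp add: lookup_coeff_deriv lookup_single when_def D_0)

lemma coeff_deriv_add: "coeff_deriv D i (P + Q) = coeff_deriv D i P + coeff_deriv D i Q"
  by (rule poly_mapping_eqI) (simp add: lookup_coeff_deriv lookup_add D_add)

lemma coeff_deriv_single_mult:
  "coeff_deriv D i (Poly_Mapping.single \<alpha> a * P)
     = Poly_Mapping.single \<alpha> (D i a) * P + Poly_Mapping.single \<alpha> a * coeff_deriv D i P"
proof (induction P rule: lpdo_induct)
  case (single \<beta> b)
  then show ?case by (simp add: mult_single coeff_deriv_single D_mult single_add)
next
  case (add p q)
  then show ?case by (simp add: coeff_deriv_add distrib_left)
qed

text \<open>
  The operators form a differential module over the field, on which they act by left multiplication
  (\<open>op_mult_eq_act\<close>). Associativity of composition is then an instance of \<open>act_op_mult\<close>.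
\<close>

lemma diff_module_op: "diff_module D op_scale (op_deriv D)"
proof
  fix a b :: 'k and i j :: 'i and P Q :: "('i, 'k) lpdo"
  show "diff_field D" by (rule df)
  show "op_scale a (P + Q) = op_scale a P + op_scale a Q"
    "op_scale (a + b) P = op_scale a P + op_scale b P"
    "op_scale a (op_scale b P) = op_scale (a * b) P" "op_scale 1 P = P"
    by (simp_all add: op_scale_def func_op_eq single_add algebra_simps mult_single mult.assoc[symmetric])
  show "op_deriv D i (P + Q) = op_deriv D i P + op_deriv D i Q"
    by (simp add: op_deriv_def coeff_deriv_add algebra_simps)
  show "op_deriv D i (op_scale a P) = op_scale (D i a) P + op_scale a (op_deriv D i P)"
    unfolding op_deriv_def op_scale_def func_op_eq coeff_deriv_single_mult by (simp add: algebra_simps)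
  have "coeff_deriv D i (coeff_deriv D j P) = coeff_deriv D j (coeff_deriv D i P)"
    by (rule poly_mapping_eqI) (simp add: lookup_coeff_deriv D_commute)
  then show "op_deriv D i (op_deriv D j P) = op_deriv D j (op_deriv D i P)"
    unfolding op_deriv_def deriv_op_eq coeff_deriv_single_mult coeff_deriv_add D_1 single_zero
    by (simp add: algebra_simps)
qed

interpretation ops: diff_module D op_scale "op_deriv D" by (rule diff_module_op)

lemma op_deriv_single_one:
  "op_deriv D i (Poly_Mapping.single \<alpha> 1) = Poly_Mapping.single (\<alpha> + unit_index i) 1"
  by (simp add: op_deriv_def deriv_op_eq mult_single coeff_deriv_single D_1 add.commute)

lemma mderiv_op_single: "mderiv (op_deriv D) \<alpha> (Poly_Mapping.single \<beta> 1) = Poly_Mapping.single (\<alpha> + \<beta>) 1"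
proof (induction \<alpha> rule: multi_index_induct)
  case zero
  show "mderiv (op_deriv D) 0 (Poly_Mapping.single \<beta> 1) = Poly_Mapping.single (0 + \<beta>) 1"
    by (simp add: mderiv_0)
next
  case (add_unit \<alpha> i)
  have IH: "mderiv (op_deriv D) \<alpha> (Poly_Mapping.single \<beta> 1) = Poly_Mapping.single (\<alpha> + \<beta>) 1"
    by (rule add_unit)
  show "mderiv (op_deriv D) (\<alpha> + unit_index i) (Poly_Mapping.single \<beta> 1)
      = Poly_Mapping.single (\<alpha> + unit_index i + \<beta>) 1"
    unfolding ops.d.mderiv_add_unit IH op_deriv_single_one by (simp add: ac_simps)
qed

lemma lpdo_generate_induct:
  assumes one: "X (func_op 1)" and add: "\<And>P Q. X P \<Longrightarrow> X Q \<Longrightarrow> X (P + Q)"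
    and scale: "\<And>P a. X P \<Longrightarrow> X (op_scale a P)" and deriv: "\<And>P i. X P \<Longrightarrow> X (op_deriv D i P)"
  shows "X P"
proof (rule lpdo_induct)
  fix \<alpha> a
  have "X (Poly_Mapping.single \<alpha> 1)"
  proof (induction \<alpha> rule: multi_index_induct)
    case zero
    show "X (Poly_Mapping.single 0 1)" using one by (simp only: func_op_eq)
  next
    case (add_unit \<alpha> i)
    then show "X (Poly_Mapping.single (\<alpha> + unit_index i) 1)"
      using deriv[of "Poly_Mapping.single \<alpha> 1" i] by (simp only: op_deriv_single_one)
  qed
  from scale[OF this, of a] show "X (Poly_Mapping.single \<alpha> a)"
    by (simp add: op_scale_def func_op_eq mult_single)
qed (rule add)

text \<open>
  The formula defining the product of operators is the Leibniz formula in the module of operators.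
\<close>

lemma op_mult_eq_act: "op_mult D P Q = ops.act P Q"
proof -
  have Q: "Q = (\<Sum>\<beta>\<in>Poly_Mapping.keys Q. op_scale (Poly_Mapping.lookup Q \<beta>) (Poly_Mapping.single \<beta> 1))"
    by (rule poly_mapping_eqI)
      (simp add: op_scale_def func_op_eq mult_single lookup_sum lookup_single when_def in_keys_iff)
  have "ops.act P Q = (\<Sum>\<alpha>\<in>Poly_Mapping.keys P. op_scale (Poly_Mapping.lookup P \<alpha>) (\<Sum>\<beta>\<in>Poly_Mapping.keys Q.
     mderiv (op_deriv D) \<alpha> (op_scale (Poly_Mapping.lookup Q \<beta>) (Poly_Mapping.single \<beta> 1))))"
    unfolding ops.act_def ops.mderiv_module_sum[symmetric] Q[symmetric] ..
  also have "\<dots> = op_mult D P Q"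
    unfolding op_mult_def ops.leibniz_binomial mderiv_op_single ops.scale_sum ops.scale_scale
    by (intro sum.cong refl)
      (simp add: op_scale_def func_op_eq mult_single plus_fun_def fun_diff_def ac_simps)
  finally show ?thesis ..
qed

end

context diff_module
begin

interpretation ops: diff_module D op_scale "op_deriv D" by (rule diff_module_op[OF diff_field])

lemma act_op_scale: "act (op_scale a P) v = scale a (act P v)"
  by (induction P rule: lpdo_induct)
    (simp_all add: op_scale_def func_op_eq mult_single act_single scale_scale act_add_left
      scale_add_right distrib_left)

lemma act_op_deriv: "act (op_deriv D i P) v = d i (act P v)"
proof (induction P rule: lpdo_induct)
  case (single \<alpha> a)
  have "unit_index i + \<alpha> = \<alpha> + unit_index i" by (rule add.commute)
  then show ?case
    by (simp add: op_deriv_def deriv_op_eq mult_single coeff_deriv_single[OF diff_field]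
        act_add_left act_single d.mderiv_add_unit d_scale add.commute)
next
  case (add P Q)
  then show ?case by (simp add: ops.d_add act_add_left d_add)
qed

text \<open>
  On any differential module the product of operators acts as composition: the action commutes with
  multiplication by functions and by the \<open>\<partial>\<^sub>i\<close> on the operator side, and these generate everything.
\<close>

theorem act_op_mult: "act (op_mult D P Q) v = act P (act Q v)"
proof -
  have "act (mderiv (op_deriv D) \<alpha> Q) v = mderiv d \<alpha> (act Q v)" for \<alpha>
  proof (induction \<alpha> rule: multi_index_induct)
    case zero
    show "act (mderiv (op_deriv D) 0 Q) v = mderiv d 0 (act Q v)" by (simp add: mderiv_0)
  next
    case (add_unit \<alpha> i)
    then show "act (mderiv (op_deriv D) (\<alpha> + unit_index i) Q) v = mderiv d (\<alpha> + unit_index i) (act Q v)"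
      by (simp add: ops.d.mderiv_add_unit d.mderiv_add_unit act_op_deriv)
  qed
  then have "act (op_mult D P Q) v
      = (\<Sum>\<alpha>\<in>Poly_Mapping.keys P. scale (Poly_Mapping.lookup P \<alpha>) (mderiv d \<alpha> (act Q v)))"
    unfolding op_mult_eq_act[OF diff_field] ops.act_def by (simp add: act_sum_left act_op_scale)
  then show ?thesis by (simp only: act_def[of P])
qed

end

section \<open>Formal power series in several variables\<close>

typedef ('i, 'k) mps = "UNIV :: (('i \<Rightarrow> nat) \<Rightarrow> 'k) set"
  morphisms mps_nth Abs_mps ..

declare Abs_mps_inverse [simplified, simp]

lemma mps_eqI: "(\<And>\<alpha>. mps_nth f \<alpha> = mps_nth g \<alpha>) \<Longrightarrow> f = g"
  by (metis mps_nth_inverse ext)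

lemma sum_splits_assoc:
  fixes h :: "('i::finite \<Rightarrow> nat) \<Rightarrow> ('i \<Rightarrow> nat) \<Rightarrow> ('i \<Rightarrow> nat) \<Rightarrow> 'v::comm_monoid_add"
  shows "(\<Sum>(\<delta>, \<gamma>)\<in>splits \<alpha>. \<Sum>(\<beta>, \<epsilon>)\<in>splits \<delta>. h \<beta> \<epsilon> \<gamma>)
       = (\<Sum>(\<beta>, \<delta>)\<in>splits \<alpha>. \<Sum>(\<epsilon>, \<gamma>)\<in>splits \<delta>. h \<beta> \<epsilon> \<gamma>)"
proof -
  have "(\<Sum>(p, q)\<in>(SIGMA p:splits \<alpha>. splits (fst p)). h (fst q) (snd q) (snd p))
      = (\<Sum>(p, q)\<in>(SIGMA p:splits \<alpha>. splits (snd p)). h (fst p) (fst q) (snd q))"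
    by (rule sum.reindex_bij_witness[of _
          "\<lambda>(p, q). ((fst p + fst q, snd q), (fst p, fst q))"
          "\<lambda>(p, q). ((fst q, snd q + snd p), (snd q, snd p))"])
      (auto simp: splits_def add.assoc)
  then show ?thesis by (simp add: sum.Sigma case_prod_unfold)
qed

lemma sum_splits_zero_left:
  fixes h :: "('i::finite \<Rightarrow> nat) \<Rightarrow> 'v::comm_semiring_1"
  shows "(\<Sum>(\<beta>, \<gamma>)\<in>splits \<alpha>. (if \<beta> = 0 then 1 else 0) * h \<gamma>) = h \<alpha>"
proof -
  have "(\<Sum>(\<beta>, \<gamma>)\<in>splits \<alpha>. (if \<beta> = 0 then 1 else 0) * h \<gamma>)
      = (\<Sum>(\<beta>, \<gamma>)\<in>{(0 :: 'i \<Rightarrow> nat, \<alpha>)}. (if \<beta> = 0 then 1 else 0) * h \<gamma>)"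
    by (rule sum.mono_neutral_right, rule finite_splits) (auto simp: splits_def split: if_splits)
  then show ?thesis by simp
qed

instantiation mps :: (finite, comm_ring_1) comm_ring_1
begin

definition "0 = Abs_mps (\<lambda>_. 0)"
definition "1 = Abs_mps (\<lambda>\<alpha>. if \<alpha> = 0 then 1 else 0)"
definition "f + g = Abs_mps (\<lambda>\<alpha>. mps_nth f \<alpha> + mps_nth g \<alpha>)"
definition "f - g = Abs_mps (\<lambda>\<alpha>. mps_nth f \<alpha> - mps_nth g \<alpha>)"
definition "- f = Abs_mps (\<lambda>\<alpha>. - mps_nth f \<alpha>)"
definition "f * g = Abs_mps (\<lambda>\<alpha>. \<Sum>(\<beta>, \<gamma>)\<in>splits \<alpha>. mps_nth f \<beta> * mps_nth g \<gamma>)"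

instance
proof
  fix f g h :: "('a, 'b) mps"
  have comm: "f * g = g * f" for f g :: "('a, 'b) mps"
    unfolding times_mps_def by (subst sum_splits_swap) (simp add: mult.commute)
  show "f * g = g * f" by (rule comm)
  show "f * g * h = f * (g * h)"
  proof (rule mps_eqI)
    fix \<alpha>
    have "mps_nth (f * g * h) \<alpha>
        = (\<Sum>(\<delta>, \<gamma>)\<in>splits \<alpha>. \<Sum>(\<beta>, \<epsilon>)\<in>splits \<delta>. mps_nth f \<beta> * mps_nth g \<epsilon> * mps_nth h \<gamma>)"
      by (simp add: times_mps_def sum_distrib_right case_prod_unfold)
    also have "\<dots> = (\<Sum>(\<beta>, \<delta>)\<in>splits \<alpha>. \<Sum>(\<epsilon>, \<gamma>)\<in>splits \<delta>. mps_nth f \<beta> * mps_nth g \<epsilon> * mps_nth h \<gamma>)"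
      by (rule sum_splits_assoc)
    also have "\<dots> = mps_nth (f * (g * h)) \<alpha>"
      by (simp add: times_mps_def sum_distrib_left case_prod_unfold mult.assoc)
    finally show "mps_nth (f * g * h) \<alpha> = mps_nth (f * (g * h)) \<alpha>" .
  qed
  show "1 * f = f"
    by (rule mps_eqI) (simp add: times_mps_def one_mps_def sum_splits_zero_left)
  show "(f + g) * h = f * h + g * h"
    by (rule mps_eqI)
      (simp add: times_mps_def plus_mps_def distrib_right sum.distrib case_prod_unfold)
  show "(0 :: ('a, 'b) mps) \<noteq> 1"
  proof
    assume "(0 :: ('a, 'b) mps) = 1"
    then have "mps_nth (0 :: ('a, 'b) mps) 0 = mps_nth (1 :: ('a, 'b) mps) 0" by simp
    then show False by (simp add: zero_mps_def one_mps_def)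
  qed
qed (rule mps_eqI; simp add: zero_mps_def plus_mps_def minus_mps_def uminus_mps_def algebra_simps)+

end

lemma mps_nth_zero [simp]: "mps_nth 0 \<alpha> = 0"
  by (simp add: zero_mps_def)

lemma mps_nth_add [simp]: "mps_nth (f + g) \<alpha> = mps_nth f \<alpha> + mps_nth g \<alpha>"
  by (simp add: plus_mps_def)

lemma mps_nth_mult: "mps_nth (f * g) \<alpha> = (\<Sum>(\<beta>, \<gamma>)\<in>splits \<alpha>. mps_nth f \<beta> * mps_nth g \<gamma>)"
  by (simp add: times_mps_def)

instance mps :: (finite, idom) idom
proof
  fix f g :: "('a, 'b) mps"
  assume "f \<noteq> 0" "g \<noteq> 0"
  then have "{\<beta>. mps_nth f \<beta> \<noteq> 0} \<noteq> {}" "{\<gamma>. mps_nth g \<gamma> \<noteq> 0} \<noteq> {}"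
    by (auto intro!: mps_eqI)
  from exists_unique_sum[OF this] obtain \<beta> \<gamma>
    where \<beta>: "mps_nth f \<beta> \<noteq> 0" and \<gamma>: "mps_nth g \<gamma> \<noteq> 0"
      and *: "\<And>\<beta>' \<gamma>'. mps_nth f \<beta>' \<noteq> 0 \<Longrightarrow> mps_nth g \<gamma>' \<noteq> 0 \<Longrightarrow> \<beta>' + \<gamma>' = \<beta> + \<gamma> \<Longrightarrow> \<beta>' = \<beta> \<and> \<gamma>' = \<gamma>"
    by blast
  have "mps_nth (f * g) (\<beta> + \<gamma>) = (\<Sum>(\<beta>', \<gamma>')\<in>{(\<beta>, \<gamma>)}. mps_nth f \<beta>' * mps_nth g \<gamma>')"
    unfolding mps_nth_mult by (rule sum.mono_neutral_right, rule finite_splits) (auto simp: splits_def dest: *)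
  then have "mps_nth (f * g) (\<beta> + \<gamma>) \<noteq> 0" using \<beta> \<gamma> by simp
  then show "f * g \<noteq> 0" by auto
qed

definition mps_deriv :: "'i \<Rightarrow> ('i, 'k::comm_ring_1) mps \<Rightarrow> ('i, 'k) mps" where
  "mps_deriv i f = Abs_mps (\<lambda>\<alpha>. of_nat (Suc (\<alpha> i)) * mps_nth f (\<alpha> + unit_index i))"

lemma mps_nth_deriv:
  "mps_nth (mps_deriv i f) \<alpha> = of_nat (Suc (\<alpha> i)) * mps_nth f (\<alpha> + unit_index i)"
  by (simp add: mps_deriv_def)

definition derivation :: "('r \<Rightarrow> 'r::comm_ring_1) \<Rightarrow> bool" where
  "derivation \<delta> \<longleftrightarrow> (\<forall>a b. \<delta> (a + b) = \<delta> a + \<delta> b) \<and> (\<forall>a b. \<delta> (a * b) = \<delta> a * b + a * \<delta> b)"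

lemma derivation_mps_deriv: "derivation (mps_deriv i :: ('i::finite, 'k::comm_ring_1) mps \<Rightarrow> _)"
  unfolding derivation_def
proof (intro conjI allI mps_eqI)
  fix f g :: "('i, 'k) mps" and \<alpha>
  show "mps_nth (mps_deriv i (f + g)) \<alpha> = mps_nth (mps_deriv i f + mps_deriv i g) \<alpha>"
    by (simp add: mps_nth_deriv distrib_left)
  let ?e = "unit_index i"
  have deg: "of_nat (\<beta> i) + of_nat (\<gamma> i) = (of_nat (Suc (\<alpha> i)) :: 'k)"
    if "(\<beta>, \<gamma>) \<in> splits (\<alpha> + ?e)" for \<beta> \<gamma>
  proof -
    have "(\<beta> + \<gamma>) i = (\<alpha> + ?e) i" using that by (simp add: splits_def)
    then have "\<beta> i + \<gamma> i = Suc (\<alpha> i)" by (simp add: unit_index_apply)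
    then show ?thesis by (metis of_nat_add)
  qed
  have "mps_nth (mps_deriv i (f * g)) \<alpha>
      = (\<Sum>(\<beta>, \<gamma>)\<in>splits (\<alpha> + ?e). of_nat (Suc (\<alpha> i)) * (mps_nth f \<beta> * mps_nth g \<gamma>))"
    by (simp add: mps_nth_deriv mps_nth_mult sum_distrib_left case_prod_unfold)
  also have "\<dots> = (\<Sum>(\<beta>, \<gamma>)\<in>splits (\<alpha> + ?e).
      of_nat (\<beta> i) * mps_nth f \<beta> * mps_nth g \<gamma> + mps_nth f \<beta> * (of_nat (\<gamma> i) * mps_nth g \<gamma>))"
    by (intro sum.cong refl) (clarsimp simp: deg[symmetric] algebra_simps simp del: of_nat_Suc)
  also have "\<dots> = (\<Sum>(\<beta>, \<gamma>)\<in>splits (\<alpha> + ?e). of_nat (\<beta> i) * mps_nth f \<beta> * mps_nth g \<gamma>)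
      + (\<Sum>(\<gamma>, \<beta>)\<in>splits (\<alpha> + ?e). mps_nth f \<beta> * (of_nat (\<gamma> i) * mps_nth g \<gamma>))"
    by (subst (3) sum_splits_swap) (simp add: sum.distrib case_prod_unfold)
  also have "(\<Sum>(\<beta>, \<gamma>)\<in>splits (\<alpha> + ?e). of_nat (\<beta> i) * mps_nth f \<beta> * mps_nth g \<gamma>)
      = mps_nth (mps_deriv i f * g) \<alpha>"
    by (subst sum_splits_add_unit) (simp_all add: mps_nth_mult mps_nth_deriv unit_index_apply)
  also have "(\<Sum>(\<gamma>, \<beta>)\<in>splits (\<alpha> + ?e). mps_nth f \<beta> * (of_nat (\<gamma> i) * mps_nth g \<gamma>))
      = (\<Sum>(\<gamma>, \<beta>)\<in>splits \<alpha>. mps_nth f \<beta> * mps_nth (mps_deriv i g) \<gamma>)"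
    by (subst sum_splits_add_unit) (simp_all add: mps_nth_deriv unit_index_apply)
  also have "\<dots> = mps_nth (f * mps_deriv i g) \<alpha>"
    unfolding mps_nth_mult by (rule sum_splits_swap)
  finally show "mps_nth (mps_deriv i (f * g)) \<alpha> = mps_nth (mps_deriv i f * g + f * mps_deriv i g) \<alpha>"
    by simp
qed

lemma mps_deriv_commute: "mps_deriv i (mps_deriv j f) = mps_deriv j (mps_deriv i f)"
proof (cases "i = j")
  case False
  show ?thesis
  proof (rule mps_eqI)
    fix \<alpha>
    have "\<alpha> + unit_index i + unit_index j = \<alpha> + unit_index j + unit_index i"
      by (simp add: ac_simps)
    then show "mps_nth (mps_deriv i (mps_deriv j f)) \<alpha> = mps_nth (mps_deriv j (mps_deriv i f)) \<alpha>"
      using False by (simp add: mps_nth_deriv unit_index_apply algebra_simps)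
  qed
qed simp

section \<open>Taylor expansion and formal solutions\<close>

definition taylor :: "('i::finite \<Rightarrow> 'k \<Rightarrow> 'k::field_char_0) \<Rightarrow> 'k \<Rightarrow> ('i, 'k) mps" where
  "taylor D a = Abs_mps (\<lambda>\<alpha>. mderiv D \<alpha> a / mfact \<alpha>)"

lemma mps_nth_taylor: "mps_nth (taylor D a) \<alpha> = mderiv D \<alpha> a / mfact \<alpha>"
  by (simp add: taylor_def)

lemma diff_module_self: "diff_field D \<Longrightarrow> diff_module D (*) D"
  by unfold_locales (auto simp: diff_field_def algebra_simps)

context
  fixes D :: "'i::finite \<Rightarrow> 'k::field_char_0 \<Rightarrow> 'k"
  assumes df: "diff_field D"
begin

interpretation self: diff_module D "(*)" D by (rule diff_module_self[OF df])

lemma taylor_add: "taylor D (a + b) = taylor D a + taylor D b"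
  by (rule mps_eqI) (simp add: mps_nth_taylor self.mderiv_module_add add_divide_distrib)

lemma taylor_mult: "taylor D (a * b) = taylor D a * taylor D b"
proof (rule mps_eqI)
  fix \<alpha>
  show "mps_nth (taylor D (a * b)) \<alpha> = mps_nth (taylor D a * taylor D b) \<alpha>"
    using self.leibniz[of \<alpha> a b] by (simp add: mps_nth_taylor mps_nth_mult)
qed

lemma mps_nth_taylor_0: "mps_nth (taylor D a) 0 = a"
  by (simp add: mps_nth_taylor mderiv_0)

text \<open>
  An idempotent other than zero in an integral domain is one.
\<close>

lemma taylor_one: "taylor D 1 = 1"
proof -
  have "taylor D 1 * taylor D 1 = taylor D 1 * 1" by (simp flip: taylor_mult)
  moreover have "taylor D 1 \<noteq> 0" using mps_nth_taylor_0[of 1] by auto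
  ultimately show ?thesis by (metis mult_left_cancel)
qed

lemma mps_deriv_taylor: "mps_deriv i (taylor D a) = taylor D (D i a)"
  by (rule mps_eqI)
    (simp add: mps_nth_taylor mps_nth_deriv self.D.mderiv_add_unit self.D.mderiv_commute
      mfact_add_unit del: of_nat_Suc)

text \<open>
  The coefficients of the series carry no derivation of their own: a field element enters through its
  Taylor expansion, and there its derivatives become derivatives with respect to the variables.
\<close>

lemma diff_module_mps: "diff_module D (\<lambda>a s. taylor D a * s) mps_deriv"
  using df derivation_mps_deriv
  by unfold_locales
    (auto simp: derivation_def taylor_add taylor_mult taylor_one mps_deriv_taylor mps_deriv_commute
      algebra_simps)

interpretation ops: diff_module D op_scale "op_deriv D" by (rule diff_module_op[OF df])
interpretation mps: diff_module D "\<lambda>a s. taylor D a * s" mps_deriv by (rule diff_module_mps)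

lemma mps_nth_mderiv_0:
  fixes s :: "('i, 'k) mps"
  shows "mps_nth (mderiv mps_deriv \<alpha> s) 0 = mfact \<alpha> * mps_nth s \<alpha>"
proof (induction \<alpha> arbitrary: s rule: multi_index_induct)
  case zero
  show "mps_nth (mderiv mps_deriv 0 s) 0 = mfact 0 * mps_nth s 0" by (simp add: mderiv_0)
next
  case (add_unit \<alpha> i)
  have "mps_nth (mderiv mps_deriv (\<alpha> + unit_index i) s) 0
      = mps_nth (mderiv mps_deriv \<alpha> (mps_deriv i s)) 0"
    by (simp add: mps.d.mderiv_add_unit mps.d.mderiv_commute)
  also have "\<dots> = mfact \<alpha> * mps_nth (mps_deriv i s) \<alpha>" by (rule add_unit)
  finally show "mps_nth (mderiv mps_deriv (\<alpha> + unit_index i) s) 0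
      = mfact (\<alpha> + unit_index i) * mps_nth s (\<alpha> + unit_index i)"
    by (simp add: mps_nth_deriv mfact_add_unit)
qed

text \<open>
  A \<open>K\<close>-linear functional \<open>\<phi>\<close> on operators is the same as a power series
  \<open>s = \<Sum>\<^sub>\<alpha> \<phi>(\<partial>\<^sup>\<alpha>) X\<^sup>\<alpha> / \<alpha>!\<close>, and \<open>\<phi>(Q)\<close> is then the value of \<open>Q s\<close> at the origin. The Taylor
  coefficients of \<open>P s\<close> are therefore, up to the factors \<open>\<alpha>!\<close>, the values of \<open>\<phi>\<close> at the operators \<open>\<partial>\<^sup>\<alpha> P\<close>.
\<close>

theorem formal_solution:
  fixes \<phi> :: "('i, 'k) lpdo \<Rightarrow> 'k"
  assumes \<phi>_add: "\<And>P Q. \<phi> (P + Q) = \<phi> P + \<phi> Q"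
    and \<phi>_scale: "\<And>a P. \<phi> (op_scale a P) = a * \<phi> P"
    and \<phi>_zero: "\<And>A. \<phi> (op_mult D A P) = 0"
  shows "mps.act P (Abs_mps (\<lambda>\<alpha>. \<phi> (Poly_Mapping.single \<alpha> 1) / mfact \<alpha>)) = 0"
proof (rule mps_eqI)
  let ?s = "Abs_mps (\<lambda>\<alpha>. \<phi> (Poly_Mapping.single \<alpha> 1) / mfact \<alpha>)"
  \<comment> \<open>the functional is evaluation at the origin\<close>
  have eval: "mps_nth (mps.act Q ?s) 0 = \<phi> Q" for Q
  proof (induction Q rule: lpdo_induct)
    case (single \<alpha> a)
    have "mps_nth (mps.act (Poly_Mapping.single \<alpha> a) ?s) 0 = a * \<phi> (Poly_Mapping.single \<alpha> 1)"
      by (simp add: mps.act_single mps_nth_mult mps_nth_taylor_0 mps_nth_mderiv_0)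
    also have "\<dots> = \<phi> (op_scale a (Poly_Mapping.single \<alpha> 1))" by (rule \<phi>_scale[symmetric])
    finally show "mps_nth (mps.act (Poly_Mapping.single \<alpha> a) ?s) 0 = \<phi> (Poly_Mapping.single \<alpha> a)"
      by (simp add: op_scale_def func_op_eq mult_single)
  next
    case (add Q R)
    have "mps_nth (mps.act Q ?s) 0 = \<phi> Q" "mps_nth (mps.act R ?s) 0 = \<phi> R" by (fact add)+
    then show "mps_nth (mps.act (Q + R) ?s) 0 = \<phi> (Q + R)"
      by (simp add: mps.act_add_left \<phi>_add)
  qed
  fix \<alpha>
  have "mfact \<alpha> * mps_nth (mps.act P ?s) \<alpha> = mps_nth (mderiv mps_deriv \<alpha> (mps.act P ?s)) 0"
    by (rule mps_nth_mderiv_0[symmetric])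
  also have "mderiv mps_deriv \<alpha> (mps.act P ?s) = mps.act (op_mult D (Poly_Mapping.single \<alpha> 1) P) ?s"
    by (simp add: mps.act_op_mult mps.act_single taylor_one)
  also have "mps_nth \<dots> 0 = 0"
    by (simp add: eval \<phi>_zero)
  finally show "mps_nth (mps.act P ?s) \<alpha> = mps_nth 0 \<alpha>" by simp
qed

text \<open>
  Linear algebra only: a basis of \<open>J\<close> together with \<open>R\<close> is independent, so values on it may be
  prescribed.
\<close>

lemma exists_separating_functional:
  assumes zero: "0 \<in> J" and add: "\<And>P Q. P \<in> J \<Longrightarrow> Q \<in> J \<Longrightarrow> P + Q \<in> J"
    and scale: "\<And>a P. P \<in> J \<Longrightarrow> op_scale a P \<in> J" and one: "R \<notin> J"
  shows "\<exists>\<phi> :: ('i, 'k) lpdo \<Rightarrow> 'k. (\<forall>P Q. \<phi> (P + Q) = \<phi> P + \<phi> Q) \<and>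
           (\<forall>a P. \<phi> (op_scale a P) = a * \<phi> P) \<and> (\<forall>P\<in>J. \<phi> P = 0) \<and> \<phi> R = 1"
proof -
  interpret vector_space_pair "op_scale :: 'k \<Rightarrow> ('i, 'k) lpdo \<Rightarrow> _" "(*) :: 'k \<Rightarrow> 'k \<Rightarrow> 'k"
    by unfold_locales
      (simp_all add: ops.scale_add_right ops.scale_add_left ops.scale_scale ops.scale_one algebra_simps)
  obtain B where B: "B \<subseteq> J" "vs1.independent B" "J \<subseteq> vs1.span B"
    by (rule vs1.maximal_independent_subset)
  have "vs1.subspace J" unfolding vs1.subspace_def using zero add scale by blast
  then have span: "vs1.span B = J" using B by (simp add: vs1.span_subspace)
  then have "vs1.independent (insert R B)"
    using B(2) one by (simp add: vs1.independent_insert)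
  from linear_independent_extend[OF this, of "\<lambda>P. if P = R then 1 else 0"]
  obtain \<phi> where \<phi>: "Vector_Spaces.linear op_scale (*) \<phi>" and ext: "\<forall>P\<in>insert R B. \<phi> P = (if P = R then 1 else 0)"
    by blast
  interpret \<phi>: Vector_Spaces.linear op_scale "(*)" \<phi> by (rule \<phi>)
  have "R \<notin> B" using one B(1) by blast
  then have "\<phi> P = 0" if "P \<in> B" for P
    using ext that by auto
  then have "\<phi> P = 0" if "P \<in> J" for P
    using \<phi>.eq_0_on_span[of B P] that span by blast
  moreover have "\<phi> R = 1" using ext by simp
  ultimately show ?thesis using \<phi>.add \<phi>.scale by (intro exI[of _ \<phi>]) simp
qed

end

section \<open>Differential extensions by fractions of power series\<close>

lemma diff_module_extension:
  fixes d :: "'i::finite \<Rightarrow> 'f::field \<Rightarrow> 'f"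
  assumes "diff_extension D class_ring d \<iota>" and df: "diff_field D"
  shows "diff_module D (\<lambda>a v. \<iota> a * v) d"
  using assms unfolding diff_extension_def
  by unfold_locales (auto simp: Ring.ring_hom_def algebra_simps)

text \<open>
  Carries solutions from one differential module to another, here from power series to their
  fractions.
\<close>

lemma act_hom:
  assumes "diff_module D scale d" "diff_module D scale' d'"
    and add: "\<And>u v. h (u + v) = h u + h v"
    and scale: "\<And>a v. h (scale a v) = scale' a (h v)"
    and deriv: "\<And>i v. h (d i v) = d' i (h v)"
  shows "h (diff_module.act scale d P v) = diff_module.act scale' d' P (h v)"
proof -
  interpret V: diff_module D scale d by fact
  interpret W: diff_module D scale' d' by fact
  have mderiv: "h (mderiv d \<alpha> v) = mderiv d' \<alpha> (h v)" for \<alpha>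
  proof (induction \<alpha> rule: multi_index_induct)
    case zero
    show "h (mderiv d 0 v) = mderiv d' 0 (h v)" by (simp add: mderiv_0)
  next
    case (add_unit \<alpha> i)
    then show "h (mderiv d (\<alpha> + unit_index i) v) = mderiv d' (\<alpha> + unit_index i) (h v)"
      by (simp add: V.d.mderiv_add_unit W.d.mderiv_add_unit deriv)
  qed
  show ?thesis
    by (induction P rule: lpdo_induct)
      (simp_all add: V.act_single W.act_single V.act_add_left W.act_add_left scale add mderiv)
qed

text \<open>
  The quotient rule. When \<open>\<delta>\<close> is a derivation, all representations of the fraction give the same
  value (\<open>fract_deriv_Fract\<close>).
\<close>

definition fract_deriv :: "('r \<Rightarrow> 'r::idom) \<Rightarrow> 'r fract \<Rightarrow> 'r fract" where
  "fract_deriv \<delta> q = (SOME r. \<exists>a b. b \<noteq> 0 \<and> q = Fract a b \<and> r = Fract (\<delta> a * b - a * \<delta> b) (b * b))"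

lemma derivation_add: "derivation \<delta> \<Longrightarrow> \<delta> (a + b) = \<delta> a + \<delta> b"
  by (simp add: derivation_def)

lemma derivation_mult: "derivation \<delta> \<Longrightarrow> \<delta> (a * b) = \<delta> a * b + a * \<delta> b"
  by (simp add: derivation_def)

lemma derivation_diff: "derivation \<delta> \<Longrightarrow> \<delta> (a - b) = \<delta> a - \<delta> b"
  by (metis add_diff_cancel_right' derivation_add diff_add_cancel)

lemma derivation_one: "derivation \<delta> \<Longrightarrow> \<delta> 1 = 0"
  using derivation_mult[of \<delta> 1 1] by simp

lemma fract_deriv_Fract:
  assumes \<delta>: "derivation \<delta>" and b: "b \<noteq> 0"
  shows "fract_deriv \<delta> (Fract a b) = Fract (\<delta> a * b - a * \<delta> b) (b * b)"
proof -
  have unique: "Fract (\<delta> c * e - c * \<delta> e) (e * e) = Fract (\<delta> a * b - a * \<delta> b) (b * b)"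
    if e: "e \<noteq> 0" and eq: "Fract a b = Fract c e" for c e
  proof -
    have ae: "a * e = c * b" using eq b e by (simp add: eq_fract)
    then have "\<delta> (a * e) = \<delta> (c * b)" by simp
    then have "\<delta> a * e + a * \<delta> e = \<delta> c * b + c * \<delta> b" by (simp add: derivation_mult[OF \<delta>])
    then have cb: "\<delta> c * b = \<delta> a * e + a * \<delta> e - c * \<delta> b" by (simp add: algebra_simps)
    have "(\<delta> c * e - c * \<delta> e) * (b * b) = e * b * (\<delta> c * b) - (c * b) * (b * \<delta> e)"
      by (simp add: algebra_simps)
    also have "\<dots> = e * b * (\<delta> a * e + a * \<delta> e - c * \<delta> b) - (a * e) * (b * \<delta> e)"
      by (simp only: cb ae)
    also have "\<dots> = e * b * (\<delta> a * e) - e * \<delta> b * (c * b)"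
      by (simp add: algebra_simps)
    also have "\<dots> = e * b * (\<delta> a * e) - e * \<delta> b * (a * e)"
      by (simp only: ae)
    also have "\<dots> = (\<delta> a * b - a * \<delta> b) * (e * e)"
      by (simp add: algebra_simps)
    finally have "(\<delta> c * e - c * \<delta> e) * (b * b) = (\<delta> a * b - a * \<delta> b) * (e * e)" .
    then show ?thesis using b e by (simp add: eq_fract)
  qed
  show ?thesis unfolding fract_deriv_def
  proof (rule some_equality)
    show "\<exists>c e. e \<noteq> 0 \<and> Fract a b = Fract c e \<and>
        Fract (\<delta> a * b - a * \<delta> b) (b * b) = Fract (\<delta> c * e - c * \<delta> e) (e * e)"
      using b by blast
  next
    fix r
    assume "\<exists>c e. e \<noteq> 0 \<and> Fract a b = Fract c e \<and> r = Fract (\<delta> c * e - c * \<delta> e) (e * e)"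
    then obtain c e where "e \<noteq> 0" "Fract a b = Fract c e"
      and r: "r = Fract (\<delta> c * e - c * \<delta> e) (e * e)" by blast
    then show "r = Fract (\<delta> a * b - a * \<delta> b) (b * b)" unfolding r by (intro unique)
  qed
qed

lemma derivation_fract_deriv:
  assumes \<delta>: "derivation \<delta>"
  shows "derivation (fract_deriv \<delta>)"
  unfolding derivation_def
proof (intro conjI allI)
  fix p q :: "'a fract"
  obtain a b c e where p: "p = Fract a b" and q: "q = Fract c e" and b: "b \<noteq> 0" and e: "e \<noteq> 0"
    by (metis Fract_cases)
  have be: "b * e \<noteq> 0" using b e by simp
  have \<delta>_simps: "\<delta> (x + y) = \<delta> x + \<delta> y" "\<delta> (x * y) = \<delta> x * y + x * \<delta> y" for x y
    using derivation_add[OF \<delta>] derivation_mult[OF \<delta>] by blast+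
  have "\<delta> (a * e + c * b) * (b * e) - (a * e + c * b) * \<delta> (b * e)
      = (\<delta> a * b - a * \<delta> b) * (e * e) + (\<delta> c * e - c * \<delta> e) * (b * b)"
    unfolding \<delta>_simps by (simp add: algebra_simps)
  moreover have "b * e * (b * e) = b * b * (e * e)" by (simp add: ac_simps)
  moreover have bb: "b * b \<noteq> 0" and ee: "e * e \<noteq> 0" using b e by simp_all
  ultimately show "fract_deriv \<delta> (p + q) = fract_deriv \<delta> p + fract_deriv \<delta> q"
    unfolding p q add_fract[OF b e] fract_deriv_Fract[OF \<delta> b] fract_deriv_Fract[OF \<delta> e]
      fract_deriv_Fract[OF \<delta> be]
    by (simp only: add_fract[OF bb ee])
  let ?N = "\<delta> (a * c) * (b * e) - a * c * \<delta> (b * e)"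
  have "(\<delta> a * b - a * \<delta> b) * c * (b * (e * e)) + a * (\<delta> c * e - c * \<delta> e) * (b * b * e) = (b * e) * ?N"
    unfolding \<delta>_simps by (simp add: algebra_simps)
  moreover have "b * b * e * (b * (e * e)) = (b * e) * (b * e * (b * e))" by (simp add: ac_simps)
  moreover have bbe: "b * b * e \<noteq> 0" and bee: "b * (e * e) \<noteq> 0" using b e by simp_all
  ultimately show "fract_deriv \<delta> (p * q) = fract_deriv \<delta> p * q + p * fract_deriv \<delta> q"
    unfolding p q mult_fract fract_deriv_Fract[OF \<delta> b] fract_deriv_Fract[OF \<delta> e]
      fract_deriv_Fract[OF \<delta> be]
    by (simp only: add_fract[OF bbe bee] mult_fract_cancel[OF be])
qed

lemma fract_deriv_commute:
  assumes \<delta>: "derivation \<delta>" and \<epsilon>: "derivation \<epsilon>" and comm: "\<And>a. \<delta> (\<epsilon> a) = \<epsilon> (\<delta> a)"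
  shows "fract_deriv \<delta> (fract_deriv \<epsilon> q) = fract_deriv \<epsilon> (fract_deriv \<delta> q)"
proof -
  obtain a b where q: "q = Fract a b" and b: "b \<noteq> 0" by (metis Fract_cases)
  have b2: "b * b \<noteq> 0" using b by simp
  have eq: "\<delta> (\<epsilon> a * b - a * \<epsilon> b) * (b * b) - (\<epsilon> a * b - a * \<epsilon> b) * \<delta> (b * b)
      = \<epsilon> (\<delta> a * b - a * \<delta> b) * (b * b) - (\<delta> a * b - a * \<delta> b) * \<epsilon> (b * b)"
    unfolding derivation_diff[OF \<delta>] derivation_diff[OF \<epsilon>] derivation_mult[OF \<delta>] derivation_mult[OF \<epsilon>] comm
    by (simp add: algebra_simps)
  show ?thesis
    unfolding q fract_deriv_Fract[OF \<delta> b] fract_deriv_Fract[OF \<epsilon> b]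
      fract_deriv_Fract[OF \<delta> b2] fract_deriv_Fract[OF \<epsilon> b2] eq ..
qed

lemma fract_deriv_embed:
  "derivation \<delta> \<Longrightarrow> fract_deriv \<delta> (Fract a 1) = Fract (\<delta> a) 1"
  by (simp add: fract_deriv_Fract derivation_one)

lemma diff_extension_mps_fract:
  fixes D :: "'a::finite \<Rightarrow> 'b::field_char_0 \<Rightarrow> 'b"
  assumes df: "diff_field D"
  shows "diff_extension D class_ring (\<lambda>i. fract_deriv (mps_deriv i)) (\<lambda>a. Fract (taylor D a) 1)"
proof -
  note der = derivation_mps_deriv
  note fder = derivation_fract_deriv[OF derivation_mps_deriv]
  show ?thesis unfolding diff_extension_def
  proof (intro conjI allI ballI)
    show "Ring.field (class_ring :: ('a, 'b) mps fract ring)" by (rule class_field.field_axioms)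
    fix i j :: 'a and a p q :: "('a, 'b) mps fract"
    show "fract_deriv (mps_deriv i) (p \<oplus>\<^bsub>class_ring\<^esub> q)
        = fract_deriv (mps_deriv i) p \<oplus>\<^bsub>class_ring\<^esub> fract_deriv (mps_deriv i) q"
      by (simp add: derivation_add[OF fder])
    show "fract_deriv (mps_deriv i) (p \<otimes>\<^bsub>class_ring\<^esub> q)
        = fract_deriv (mps_deriv i) p \<otimes>\<^bsub>class_ring\<^esub> q \<oplus>\<^bsub>class_ring\<^esub> p \<otimes>\<^bsub>class_ring\<^esub> fract_deriv (mps_deriv i) q"
      by (simp add: derivation_mult[OF fder])
    show "fract_deriv (mps_deriv i) (fract_deriv (mps_deriv j) p)
        = fract_deriv (mps_deriv j) (fract_deriv (mps_deriv i) p)"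
      by (intro fract_deriv_commute der mps_deriv_commute)
  next
    show "(\<lambda>a. Fract (taylor D a) 1) \<in> Ring.ring_hom class_ring class_ring"
    proof (rule Ring.ring_hom_memI)
      fix a b
      show "Fract (taylor D (a \<otimes>\<^bsub>class_ring\<^esub> b)) 1 = Fract (taylor D a) 1 \<otimes>\<^bsub>class_ring\<^esub> Fract (taylor D b) 1"
        unfolding monoid.select_convs taylor_mult[OF df] by simp
      show "Fract (taylor D (a \<oplus>\<^bsub>class_ring\<^esub> b)) 1 = Fract (taylor D a) 1 \<oplus>\<^bsub>class_ring\<^esub> Fract (taylor D b) 1"
        unfolding ring.select_convs taylor_add[OF df] by simp
      show "Fract (taylor D \<one>\<^bsub>class_ring\<^esub>) 1 = \<one>\<^bsub>class_ring\<^esub>"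
        unfolding monoid.select_convs taylor_one[OF df] One_fract_def ..
    qed simp
  qed (simp_all add: fract_deriv_embed[OF der] mps_deriv_taylor[OF df])
qed

text \<open>
  A fraction is a pair of series, and a series is a family indexed by the countable set of
  exponents; so fractions of series can be encoded as sequences in the field, as
  \<open>differentially_closed\<close> and \<open>contains_solutions\<close> demand of an extension.
\<close>

lemma exists_inj_mps_fract: "\<exists>e :: ('i::finite, 'k::idom) mps fract \<Rightarrow> nat \<Rightarrow> 'k. inj e"
proof -
  have "\<exists>r :: ('i, 'k) mps fract \<Rightarrow> ('i, 'k) mps \<times> ('i, 'k) mps. inj r"
  proof -
    have "\<forall>q :: ('i, 'k) mps fract. \<exists>p. q = Fract (fst p) (snd p)"
      by (metis Fract_cases fst_conv snd_conv)
    then obtain r :: "('i, 'k) mps fract \<Rightarrow> ('i, 'k) mps \<times> ('i, 'k) mps"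
      where "\<And>q. q = Fract (fst (r q)) (snd (r q))" by metis
    then have "inj r" by (intro injI) metis
    then show ?thesis by blast
  qed
  then obtain r :: "('i, 'k) mps fract \<Rightarrow> ('i, 'k) mps \<times> ('i, 'k) mps" where r: "inj r" by blast
  let ?g = "\<lambda>(p :: ('i, 'k) mps \<times> ('i, 'k) mps) (b, \<alpha>). mps_nth (if b then fst p else snd p) \<alpha>"
  have g: "inj ?g"
  proof (rule injI)
    fix p q
    assume eq: "?g p = ?g q"
    have "mps_nth (fst p) \<alpha> = mps_nth (fst q) \<alpha>" "mps_nth (snd p) \<alpha> = mps_nth (snd q) \<alpha>" for \<alpha>
      using fun_cong[OF eq, of "(True, \<alpha>)"] fun_cong[OF eq, of "(False, \<alpha>)"] by simp_all
    then show "p = q" by (simp add: prod_eq_iff mps_eqI)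
  qed
  let ?h = "\<lambda>(f :: bool \<times> ('i \<Rightarrow> nat) \<Rightarrow> 'k) n. f (from_nat n)"
  have h: "inj ?h"
  proof (rule injI, rule ext)
    fix f f' :: "bool \<times> ('i \<Rightarrow> nat) \<Rightarrow> 'k" and x :: "bool \<times> ('i \<Rightarrow> nat)"
    assume "?h f = ?h f'"
    then have "?h f (to_nat x) = ?h f' (to_nat x)" by (rule fun_cong)
    then show "f x = f' x" by (simp only: from_nat_to_nat)
  qed
  show ?thesis using inj_compose[OF h inj_compose[OF g r]] by blast
qed

lemma diff_extension_copy:
  fixes d :: "'i::finite \<Rightarrow> 'f::field \<Rightarrow> 'f"
  assumes ext: "diff_extension D class_ring d \<iota>" and inj: "inj e"
  shows "diff_extension D (image_ring e class_ring) (\<lambda>i x. e (d i (inv_into UNIV e x))) (\<lambda>a. e (\<iota> a))"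
proof -
  have "Ring.field (image_ring e (class_ring :: 'f ring))"
    by (rule field.inj_imp_image_ring_is_field) (use inj in \<open>auto simp: class_field.field_axioms\<close>)
  then show ?thesis using ext inj unfolding diff_extension_def
    by (auto simp: image_ring_def image_group_def monoid.defs Ring.ring_hom_def)
qed

lemma dp_eval_copy:
  assumes "inj e"
  shows "dp_eval (image_ring e class_ring) (\<lambda>i x. e (d i (inv_into UNIV e x))) (\<lambda>a. e (\<iota> a)) (\<lambda>j. e (u j)) p
       = e (dp_eval class_ring d \<iota> u p)"
  using assms by (induction p) (auto simp: image_ring_def image_group_def monoid.defs)

lemma solvable_in_copy:
  fixes d :: "'i::finite \<Rightarrow> 'f::field \<Rightarrow> 'f"
  assumes "solvable_in class_ring d \<iota> P q" and inj: "inj e"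
  shows "solvable_in (image_ring e class_ring) (\<lambda>i x. e (d i (inv_into UNIV e x))) (\<lambda>a. e (\<iota> a)) P q"
proof -
  obtain u where u: "\<forall>p\<in>P. dp_eval class_ring d \<iota> u p = 0" "dp_eval class_ring d \<iota> u q \<noteq> 0"
    using assms by (auto simp: solvable_in_def)
  have "zero (image_ring e (class_ring :: 'f ring)) = e 0"
    "carrier (image_ring e (class_ring :: 'f ring)) = range e"
    by (simp_all add: image_ring_def image_group_def monoid.defs)
  then show ?thesis unfolding solvable_in_def
    using u inj by (intro exI[of _ "\<lambda>j. e (u j)"]) (simp add: dp_eval_copy inj_eq)
qed

section \<open>Solving linear systems in the field\<close>

text \<open>
  On expressions accepted by \<open>linear_dpoly\<close> this is the operator that the expression applies to its
  unknown; the clauses for \<open>Coeff\<close> and \<open>Mul\<close> are arranged so that \<open>Mul (Coeff a) p\<close> is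
  multiplication by \<open>a\<close>.
\<close>

primrec dpoly_op ::
    "('i::finite \<Rightarrow> 'k \<Rightarrow> 'k::field_char_0) \<Rightarrow> ('k, 'i) dpoly \<Rightarrow> ('i, 'k) lpdo" where
  "dpoly_op D (Coeff a) = func_op a"
| "dpoly_op D (Unk j) = func_op 1"
| "dpoly_op D (Add p q) = dpoly_op D p + dpoly_op D q"
| "dpoly_op D (Mul p q) = op_mult D (dpoly_op D p) (dpoly_op D q)"
| "dpoly_op D (Der i p) = op_deriv D i (dpoly_op D p)"

lemma dp_eval_linear:
  fixes d :: "'i::finite \<Rightarrow> 'f::field \<Rightarrow> 'f"
  assumes ext: "diff_extension D class_ring d \<iota>" and df: "diff_field D" and "linear_dpoly p"
  shows "dp_eval class_ring d \<iota> u p = diff_module.act (\<lambda>a v. \<iota> a * v) d (dpoly_op D p) (u 0)"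
proof -
  interpret F: diff_module D "\<lambda>a v. \<iota> a * v" d by (rule diff_module_extension[OF ext df])
  have "\<iota> 1 = 1" using F.scale_one[of 1] by simp
  show ?thesis using \<open>linear_dpoly p\<close>
    by induction (simp_all add: \<open>\<iota> 1 = 1\<close> F.act_func_op F.act_add_left F.act_op_mult F.act_op_deriv)
qed

lemma op_mult_func_op: "diff_field D \<Longrightarrow> op_mult D (func_op a) P = op_scale a P"
  using diff_module.act_func_op[OF diff_module_op] by (simp add: op_mult_eq_act)

lemma exists_linear_dpoly:
  assumes df: "diff_field D"
  shows "\<exists>p. linear_dpoly p \<and> dpoly_op D p = P"
proof (induction P rule: lpdo_generate_induct[OF df, case_names one add scale deriv])
  case one
  show ?case using linear_dpoly.intros(1) dpoly_op.simps(2) by blast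
next
  case (add P Q)
  then show ?case using linear_dpoly.intros(2) dpoly_op.simps(3) by metis
next
  case (scale P a)
  then obtain p where "linear_dpoly p" "dpoly_op D p = P" by blast
  then have "linear_dpoly (Mul (Coeff a) p) \<and> dpoly_op D (Mul (Coeff a) p) = op_scale a P"
    by (simp add: linear_dpoly.intros op_mult_func_op[OF df])
  then show ?case by blast
next
  case (deriv P i)
  then show ?case using linear_dpoly.intros(4) dpoly_op.simps(5) by metis
qed

lemma op_apply_eq_act: "diff_field D \<Longrightarrow> op_apply D P a = diff_module.act (*) D P a"
  by (simp add: op_apply_def diff_module.act_def[OF diff_module_self])

text \<open>
  The left ideal \<open>J\<close> holds the linear consequences of the system, and they do not include
  \<open>\<psi> = 0\<close>. A functional that vanishes on the left ideal but not at \<open>1\<close> yields a formal power series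
  solution with constant term \<open>1\<close>; it lives in the fraction field of the power series ring, a
  differential extension, and the hypothesis on the field brings a solution back.
\<close>

theorem linear_nullstellensatz:
  fixes D :: "'i::finite \<Rightarrow> 'k::field_char_0 \<Rightarrow> 'k" and S :: "('i, 'k) lpdo set"
  assumes df: "diff_field D"
    and closed: "differentially_closed D \<or> contains_solutions D"
    and S: "finite S" "S \<subseteq> J"
    and zero: "0 \<in> J" and add: "\<And>P Q. P \<in> J \<Longrightarrow> Q \<in> J \<Longrightarrow> P + Q \<in> J"
    and mult: "\<And>A P. P \<in> J \<Longrightarrow> op_mult D A P \<in> J"
    and proper: "func_op 1 \<notin> J"
  shows "\<exists>\<psi>. \<psi> \<noteq> 0 \<and> (\<forall>P\<in>S. op_apply D P \<psi> = 0)"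
proof -
  interpret mps: diff_module D "\<lambda>a s. taylor D a * s" mps_deriv by (rule diff_module_mps[OF df])
  let ?d = "\<lambda>i. fract_deriv (mps_deriv i) :: ('i, 'k) mps fract \<Rightarrow> _"
  let ?\<iota> = "\<lambda>a. Fract (taylor D a) 1 :: ('i, 'k) mps fract"
  have ext: "diff_extension D class_ring ?d ?\<iota>" by (rule diff_extension_mps_fract[OF df])
  have "op_scale a P \<in> J" if "P \<in> J" for a P
    using mult[OF that, of "func_op a"] by (simp add: op_mult_func_op[OF df])
  from exists_separating_functional[OF df zero add this proper] obtain \<phi> :: "('i, 'k) lpdo \<Rightarrow> 'k"
    where \<phi>: "\<And>P Q. \<phi> (P + Q) = \<phi> P + \<phi> Q" "\<And>a P. \<phi> (op_scale a P) = a * \<phi> P"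
      and \<phi>J: "\<And>P. P \<in> J \<Longrightarrow> \<phi> P = 0" and \<phi>1: "\<phi> (func_op 1) = 1"
    by blast
  define s where "s = Abs_mps (\<lambda>\<alpha>. \<phi> (Poly_Mapping.single \<alpha> 1) / mfact \<alpha>)"
  have act_s: "mps.act P s = 0" if "P \<in> S" for P
    unfolding s_def using that S(2) by (intro formal_solution[OF df] \<phi> \<phi>J mult) auto
  have "mps_nth s 0 = 1" using \<phi>1 by (simp add: s_def func_op_eq)
  then have s: "s \<noteq> 0" by auto
  have act_fract: "diff_module.act (\<lambda>a v. ?\<iota> a * v) ?d P (Fract s 1) = Fract (mps.act P s) 1" for P
    by (rule act_hom[OF diff_module_mps[OF df] diff_module_extension[OF ext df], symmetric])
      (simp_all add: fract_deriv_embed[OF derivation_mps_deriv])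
  obtain p where p: "\<And>P. linear_dpoly (p P)" "\<And>P. dpoly_op D (p P) = P"
    using exists_linear_dpoly[OF df] by metis
  have fract_zero: "Fract r 1 = 0 \<longleftrightarrow> r = 0" for r :: "('i, 'k) mps"
    by (simp add: Zero_fract_def eq_fract)
  have "solvable_in class_ring ?d ?\<iota> (p ` S) (Unk 0)"
    unfolding solvable_in_def
    using s by (intro exI[of _ "\<lambda>_. Fract s 1"])
      (auto simp: dp_eval_linear[OF ext df p(1)] p(2) act_fract act_s fract_zero)
  moreover obtain e :: "('i, 'k) mps fract \<Rightarrow> nat \<Rightarrow> 'k" where e: "inj e"
    using exists_inj_mps_fract by blast
  ultimately have ex: "\<exists>(R :: (nat \<Rightarrow> 'k) ring) d \<iota>. diff_extension D R d \<iota> \<and> solvable_in R d \<iota> (p ` S) (Unk 0)"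
    using diff_extension_copy[OF ext e] solvable_in_copy[OF _ e] by blast
  have fin: "finite (p ` S)" and lin: "\<forall>q\<in>p ` S. linear_dpoly q" using S(1) p(1) by auto
  have "solvable_in class_ring D id (p ` S) (Unk 0)"
    using closed
  proof
    assume "differentially_closed D"
    then show ?thesis unfolding differentially_closed_def using ex fin by blast
  next
    assume "contains_solutions D"
    then show ?thesis unfolding contains_solutions_def using ex fin lin by blast
  qed
  then obtain u where u: "\<And>P. P \<in> S \<Longrightarrow> dp_eval class_ring D id u (p P) = 0" "u 0 \<noteq> 0"
    by (auto simp: solvable_in_def)
  have "diff_extension D class_ring D id"
    using df unfolding diff_extension_def diff_field_def
    by (auto simp: class_field.field_axioms ring_hom_def)
  then have "op_apply D P (u 0) = 0" if "P \<in> S" for P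
    using u(1)[OF that] dp_eval_linear[OF _ df p(1), of D id u P] by (simp add: p(2) op_apply_eq_act[OF df])
  then show ?thesis using u(2) by blast
qed

section \<open>Degrees of products\<close>

context
  fixes D :: "'i::finite \<Rightarrow> 'k::field_char_0 \<Rightarrow> 'k"
  assumes df: "diff_field D"
begin

interpretation ops: diff_module D op_scale "op_deriv D" by (rule diff_module_op[OF df])
interpretation self: diff_module D "(*)" D by (rule diff_module_self[OF df])

abbreviation op_prod (infixl "\<odot>" 70) where "P \<odot> Q \<equiv> op_mult D P Q"

lemma op_mult_add_left: "(P + Q) \<odot> R = P \<odot> R + Q \<odot> R"
  by (simp add: op_mult_eq_act[OF df] ops.act_add_left)

lemma op_mult_add_right: "P \<odot> (Q + R) = P \<odot> Q + P \<odot> R"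
  by (simp add: op_mult_eq_act[OF df] ops.act_add_right)

lemma op_mult_zero_left: "0 \<odot> P = 0"
  by (simp add: op_mult_eq_act[OF df])

lemma op_mult_diff_left: "(P - Q) \<odot> R = P \<odot> R - Q \<odot> R"
  using op_mult_add_left[of "P - Q" Q R] by simp

lemma op_mult_assoc: "P \<odot> Q \<odot> R = P \<odot> (Q \<odot> R)"
  using ops.act_op_mult[of P Q R] by (simp add: op_mult_eq_act[OF df])

lemma func_op_mult_func_op: "func_op a \<odot> func_op b = func_op (a * b)"
  unfolding op_mult_func_op[OF df] by (simp add: op_scale_def func_op_eq mult_single)

lemma op_mult_single_one: "P \<odot> Poly_Mapping.single \<beta> 1 = P * Poly_Mapping.single \<beta> 1"
  unfolding op_mult_eq_act[OF df]
proof (induction P rule: lpdo_induct)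
  case (single \<alpha> a)
  show ?case unfolding ops.act_single mderiv_op_single[OF df]
    by (simp add: op_scale_def func_op_eq mult_single)
next
  case (add p q)
  then show ?case by (simp add: ops.act_add_left distrib_right)
qed

lemma op_mult_func_one: "P \<odot> func_op 1 = P"
  using op_mult_single_one[of P 0] by (simp add: func_op_eq)

lemma func_one_op_mult: "func_op 1 \<odot> P = P"
  by (simp add: op_mult_func_op[OF df] ops.scale_one)

lemma deriv_op_mult: "deriv_op i \<odot> P = op_deriv D i P"
  using ops.act_single[of "unit_index i" 1 P]
  by (simp add: op_mult_eq_act[OF df] deriv_op_eq ops.scale_one ops.d.mderiv_unit)

lemma deriv_op_commutator: "deriv_op i \<odot> P = P \<odot> deriv_op i + coeff_deriv D i P"
  unfolding deriv_op_mult by (simp add: op_deriv_def deriv_op_eq op_mult_single_one mult.commute)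

lemma op_apply_deriv_func: "op_apply D (deriv_op i + func_op m) g = D i g + m * g"
  by (simp add: op_apply_eq_act[OF df] self.act_add_left self.act_func_op deriv_op_eq
      self.act_single ops.D.mderiv_unit)

text \<open>
  The total order \<open>mdeg\<close> and the degree in a single derivation are the weights of interest.
\<close>

definition weight :: "(('i \<Rightarrow> nat) \<Rightarrow> nat) \<Rightarrow> bool" where
  "weight w \<longleftrightarrow> (\<forall>\<alpha> \<beta>. w (\<alpha> + \<beta>) = w \<alpha> + w \<beta>)"

definition weight_le :: "(('i \<Rightarrow> nat) \<Rightarrow> nat) \<Rightarrow> nat \<Rightarrow> ('i, 'k) lpdo \<Rightarrow> bool" where
  "weight_le w n P \<longleftrightarrow> (\<forall>\<alpha>\<in>Poly_Mapping.keys P. w \<alpha> \<le> n)"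

lemma weight_mdeg: "weight mdeg"
  by (simp add: weight_def mdeg_add)

lemma weight_eval: "weight (\<lambda>\<alpha>. \<alpha> i)"
  by (simp add: weight_def)

lemma weight_zero: "weight w \<Longrightarrow> w 0 = 0"
  unfolding weight_def by (metis add.right_neutral add_left_cancel)

lemma weight_mono: "weight w \<Longrightarrow> \<alpha> \<le> \<beta> \<Longrightarrow> w \<alpha> \<le> w \<beta>"
proof -
  assume w: "weight w" and "\<alpha> \<le> \<beta>"
  then have "\<beta> = \<alpha> + (\<beta> - \<alpha>)" by (simp add: fun_eq_iff le_fun_def)
  then show ?thesis using w unfolding weight_def by (metis le_add1)
qed

lemma weight_le_zero: "weight_le w n 0"
  by (simp add: weight_le_def)

lemma weight_le_add: "weight_le w n P \<Longrightarrow> weight_le w n Q \<Longrightarrow> weight_le w n (P + Q)"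
  unfolding weight_le_def using Poly_Mapping.keys_add[of P Q] by blast

lemma weight_le_diff: "weight_le w n P \<Longrightarrow> weight_le w n Q \<Longrightarrow> weight_le w n (P - Q)"
proof -
  assume PQ: "weight_le w n P" "weight_le w n Q"
  have "Poly_Mapping.keys (P - Q) \<subseteq> Poly_Mapping.keys P \<union> Poly_Mapping.keys Q"
    by (auto simp: in_keys_iff lookup_minus)
  with PQ show ?thesis unfolding weight_le_def by blast
qed

lemma weight_le_func_op: "weight w \<Longrightarrow> weight_le w 0 (func_op a)"
  by (simp add: weight_le_def func_op_eq weight_zero)

lemma weight_le_deriv_op: "w (unit_index i) \<le> n \<Longrightarrow> weight_le w n (deriv_op i)"
  by (simp add: weight_le_def deriv_op_eq)

lemma weight_le_coeff_deriv: "weight_le w n P \<Longrightarrow> weight_le w n (coeff_deriv D i P)"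
  by (auto simp: weight_le_def in_keys_iff lookup_coeff_deriv[OF df] D_0[OF df])

lemma keys_op_mult:
  assumes "\<kappa> \<in> Poly_Mapping.keys (P \<odot> Q)"
  shows "\<exists>\<alpha>\<in>Poly_Mapping.keys P. \<exists>\<beta>\<in>Poly_Mapping.keys Q. \<kappa> \<le> \<alpha> + \<beta>"
proof (rule ccontr)
  assume "\<not> ?thesis"
  then have "(\<lambda>i. \<alpha> i - \<gamma> i + \<beta> i) \<noteq> \<kappa>"
    if "\<alpha> \<in> Poly_Mapping.keys P" "\<beta> \<in> Poly_Mapping.keys Q" for \<alpha> \<beta> \<gamma>
    using that by (force simp: le_fun_def)
  then have "Poly_Mapping.lookup (P \<odot> Q) \<kappa> = 0"
    unfolding op_mult_def lookup_sum by (intro sum.neutral ballI) (simp add: lookup_single_not_eq)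
  then show False using assms by (simp add: in_keys_iff)
qed

lemma weight_le_mult:
  assumes w: "weight w" and "weight_le w m P" "weight_le w n Q"
  shows "weight_le w (m + n) (P \<odot> Q)"
  unfolding weight_le_def
proof
  fix \<kappa>
  assume "\<kappa> \<in> Poly_Mapping.keys (P \<odot> Q)"
  then obtain \<alpha> \<beta> where "\<alpha> \<in> Poly_Mapping.keys P" "\<beta> \<in> Poly_Mapping.keys Q" and \<kappa>: "\<kappa> \<le> \<alpha> + \<beta>"
    using keys_op_mult by blast
  then have "w \<alpha> \<le> m" "w \<beta> \<le> n" using assms by (auto simp: weight_le_def)
  moreover have "w \<kappa> \<le> w \<alpha> + w \<beta>" using weight_mono[OF w \<kappa>] w by (simp add: weight_def)
  ultimately show "w \<kappa> \<le> m + n" by simp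
qed

lemma exists_maximizer:
  fixes f :: "'a \<Rightarrow> nat"
  assumes "finite A" "A \<noteq> {}"
  shows "{a \<in> A. \<forall>b\<in>A. f b \<le> f a} \<noteq> {}"
proof -
  have "Max (f ` A) \<in> f ` A" using assms by simp
  then obtain a where "a \<in> A" "f a = Max (f ` A)" by auto
  then have "a \<in> {a \<in> A. \<forall>b\<in>A. f b \<le> f a}" using assms by simp
  then show ?thesis by blast
qed

text \<open>
  Moving derivations past coefficients only lowers exponents, so the coefficient at an exponent that
  is dominated by no other sum of exponents is the product of the two coefficients.
\<close>

lemma lookup_op_mult_extremal:
  assumes \<beta>: "\<beta> \<in> Poly_Mapping.keys P" and \<gamma>: "\<gamma> \<in> Poly_Mapping.keys Q"
    and extremal: "\<And>\<alpha> \<delta>. \<alpha> \<in> Poly_Mapping.keys P \<Longrightarrow> \<delta> \<in> Poly_Mapping.keys Q \<Longrightarrow> \<beta> + \<gamma> \<le> \<alpha> + \<delta>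
          \<Longrightarrow> \<alpha> = \<beta> \<and> \<delta> = \<gamma>"
  shows "Poly_Mapping.lookup (P \<odot> Q) (\<beta> + \<gamma>) = Poly_Mapping.lookup P \<beta> * Poly_Mapping.lookup Q \<gamma>"
proof -
  define c where "c \<alpha> \<delta> \<rho> = (of_nat (\<Prod>i\<in>UNIV. \<alpha> i choose \<rho> i) * Poly_Mapping.lookup P \<alpha>
     * mderiv D \<rho> (Poly_Mapping.lookup Q \<delta>))" for \<alpha> \<delta> \<rho> :: "'i \<Rightarrow> nat"
  define T where "T \<alpha> \<delta> \<rho> = Poly_Mapping.lookup
     (Poly_Mapping.single (\<lambda>i. \<alpha> i - \<rho> i + \<delta> i) (c \<alpha> \<delta> \<rho>)) (\<beta> + \<gamma>)" for \<alpha> \<delta> \<rho> :: "'i \<Rightarrow> nat"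
  have T_eq_0: "T \<alpha> \<delta> \<rho> = 0" if "\<alpha> \<in> Poly_Mapping.keys P" "\<delta> \<in> Poly_Mapping.keys Q" "\<rho> \<le> \<alpha>"
    and ne: "(\<alpha>, \<delta>, \<rho>) \<noteq> (\<beta>, \<gamma>, 0)" for \<alpha> \<delta> \<rho>
  proof -
    have "(\<lambda>i. \<alpha> i - \<rho> i + \<delta> i) \<noteq> \<beta> + \<gamma>"
    proof
      assume eq: "(\<lambda>i. \<alpha> i - \<rho> i + \<delta> i) = \<beta> + \<gamma>"
      have pt: "\<alpha> i - \<rho> i + \<delta> i = \<beta> i + \<gamma> i" for i
        using fun_cong[OF eq, of i] by simp
      have "\<beta> + \<gamma> \<le> \<alpha> + \<delta>" unfolding le_fun_def using pt by (auto simp flip: pt)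
      then have "\<alpha> = \<beta>" "\<delta> = \<gamma>" using extremal that by blast+
      moreover have "\<rho> = 0"
      proof
        fix i
        have "\<rho> i \<le> \<alpha> i" using that(3) by (simp add: le_fun_def)
        then show "\<rho> i = 0 i" using pt[of i] \<open>\<alpha> = \<beta>\<close> \<open>\<delta> = \<gamma>\<close> by simp
      qed
      ultimately show False using ne by blast
    qed
    then show ?thesis by (simp add: T_def lookup_single_not_eq)
  qed
  have "Poly_Mapping.lookup (P \<odot> Q) (\<beta> + \<gamma>)
      = (\<Sum>\<alpha>\<in>Poly_Mapping.keys P. \<Sum>\<delta>\<in>Poly_Mapping.keys Q. \<Sum>\<rho>\<in>{\<rho>. \<rho> \<le> \<alpha>}. T \<alpha> \<delta> \<rho>)"
    unfolding op_mult_def lookup_sum T_def c_def ..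
  also have "\<dots> = (\<Sum>\<delta>\<in>Poly_Mapping.keys Q. \<Sum>\<rho>\<in>{\<rho>. \<rho> \<le> \<beta>}. T \<beta> \<delta> \<rho>)"
    by (subst sum.remove[OF finite_keys \<beta>]) (auto simp: T_eq_0 intro!: sum.neutral)
  also have "\<dots> = (\<Sum>\<rho>\<in>{\<rho>. \<rho> \<le> \<beta>}. T \<beta> \<gamma> \<rho>)"
    by (subst sum.remove[OF finite_keys \<gamma>]) (auto simp: T_eq_0 \<beta> intro!: sum.neutral)
  also have "\<dots> = T \<beta> \<gamma> 0"
    by (subst sum.remove[OF finite_multi_index_le, of 0])
      (auto simp: T_eq_0 \<beta> \<gamma> le_fun_def intro!: sum.neutral)
  also have "\<dots> = Poly_Mapping.lookup P \<beta> * Poly_Mapping.lookup Q \<gamma>"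
    by (simp add: T_def c_def mderiv_0 plus_fun_def)
  finally show ?thesis .
qed

text \<open>
  Since \<open>w\<close> may ignore some variables, the terms of maximal degree are narrowed further to
  those of maximal total degree: a sum that dominates the sum of two such exponents is then equal to it, and among these some sum occurs
  only once. Its coefficient is a product of nonzero coefficients, so degrees add under composition.
\<close>

theorem exists_top_key:
  assumes w: "weight w" and P: "P \<noteq> 0" and Q: "Q \<noteq> 0"
  shows "\<exists>\<beta>\<in>Poly_Mapping.keys P. \<exists>\<gamma>\<in>Poly_Mapping.keys Q. \<beta> + \<gamma> \<in> Poly_Mapping.keys (P \<odot> Q) \<and>
           weight_le w (w \<beta>) P \<and> weight_le w (w \<gamma>) Q"
proof -
  define top where "top f A = {a \<in> A. \<forall>b\<in>A. f b \<le> f a}" for f :: "('i \<Rightarrow> nat) \<Rightarrow> nat" and A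
  let ?A = "Poly_Mapping.keys P" and ?B = "Poly_Mapping.keys Q"
  let ?A' = "top w ?A" and ?B' = "top w ?B"
  have ne: "?A \<noteq> {}" "?B \<noteq> {}" using P Q by auto
  have top_ne: "top f A \<noteq> {}" if "finite A" "A \<noteq> {}" for f A
    unfolding top_def using that by (rule exists_maximizer)
  have finite_top: "finite (top f A)" if "finite A" for f A using that by (simp add: top_def)
  have "top mdeg ?A' \<noteq> {}" "top mdeg ?B' \<noteq> {}"
    by (intro top_ne finite_top finite_keys ne)+
  from exists_unique_sum[OF this] obtain \<beta> \<gamma> where \<beta>: "\<beta> \<in> top mdeg ?A'" and \<gamma>: "\<gamma> \<in> top mdeg ?B'"
    and unique: "\<forall>\<beta>'\<in>top mdeg ?A'. \<forall>\<gamma>'\<in>top mdeg ?B'. \<beta>' + \<gamma>' = \<beta> + \<gamma> \<longrightarrow> \<beta>' = \<beta> \<and> \<gamma>' = \<gamma>"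
    by (elim bexE)
  have \<beta>\<gamma>: "\<beta> \<in> ?A'" "\<gamma> \<in> ?B'" "\<beta> \<in> ?A" "\<gamma> \<in> ?B" using \<beta> \<gamma> by (auto simp: top_def)
  have le_sum: "a = a' \<and> b = b'" if "a \<le> a'" "b \<le> b'" "a' + b' \<le> a + b" for a b a' b' :: nat
    using that by simp
  have extremal: "\<alpha> = \<beta> \<and> \<delta> = \<gamma>" if \<alpha>: "\<alpha> \<in> ?A" and \<delta>: "\<delta> \<in> ?B" and le: "\<beta> + \<gamma> \<le> \<alpha> + \<delta>" for \<alpha> \<delta>
  proof -
    have "w \<beta> + w \<gamma> \<le> w \<alpha> + w \<delta>" using weight_mono[OF w le] w by (simp add: weight_def)
    moreover have "w \<alpha> \<le> w \<beta>" "w \<delta> \<le> w \<gamma>" using \<beta>\<gamma> \<alpha> \<delta> by (auto simp: top_def)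
    ultimately have "w \<alpha> = w \<beta>" "w \<delta> = w \<gamma>" using le_sum by blast+
    then have \<alpha>': "\<alpha> \<in> ?A'" and \<delta>': "\<delta> \<in> ?B'" using \<beta>\<gamma> \<alpha> \<delta> by (auto simp: top_def)
    have "mdeg \<beta> + mdeg \<gamma> \<le> mdeg \<alpha> + mdeg \<delta>"
      using weight_mono[OF weight_mdeg le] by (simp add: mdeg_add)
    moreover have "mdeg \<alpha> \<le> mdeg \<beta>" "mdeg \<delta> \<le> mdeg \<gamma>"
      using \<beta> \<gamma> \<alpha>' \<delta>' by (auto simp: top_def[of mdeg])
    ultimately have deg: "mdeg \<alpha> = mdeg \<beta>" "mdeg \<delta> = mdeg \<gamma>" using le_sum by blast+
    then have top: "\<alpha> \<in> top mdeg ?A'" "\<delta> \<in> top mdeg ?B'"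
      using \<beta> \<gamma> \<alpha>' \<delta>' by (auto simp: top_def[of mdeg])
    have split: "\<alpha> + \<delta> = \<beta> + \<gamma> + (\<alpha> + \<delta> - (\<beta> + \<gamma>))"
      using le by (simp add: le_fun_def fun_eq_iff)
    then have "mdeg (\<alpha> + \<delta>) = mdeg (\<beta> + \<gamma>) + mdeg (\<alpha> + \<delta> - (\<beta> + \<gamma>))" by (metis mdeg_add)
    then have "\<alpha> + \<delta> - (\<beta> + \<gamma>) = 0" using deg by (simp add: mdeg_add mdeg_eq_0_iff)
    then have "\<alpha> + \<delta> = \<beta> + \<gamma>" using split by (metis add.right_neutral)
    then show ?thesis using unique top by blast
  qed
  have "Poly_Mapping.lookup (P \<odot> Q) (\<beta> + \<gamma>) = Poly_Mapping.lookup P \<beta> * Poly_Mapping.lookup Q \<gamma>"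
    by (rule lookup_op_mult_extremal[OF \<beta>\<gamma>(3,4) extremal])
  then have "\<beta> + \<gamma> \<in> Poly_Mapping.keys (P \<odot> Q)" using \<beta>\<gamma>(3,4) by (simp add: in_keys_iff)
  moreover have "weight_le w (w \<beta>) P" "weight_le w (w \<gamma>) Q"
    using \<beta>\<gamma> by (auto simp: weight_le_def top_def)
  ultimately show ?thesis using \<beta>\<gamma>(3,4) by blast
qed

lemma weight_le_mdeg_0:
  assumes "weight_le mdeg 0 P"
  obtains f where "P = func_op f"
proof
  show "P = func_op (Poly_Mapping.lookup P 0)"
  proof (rule poly_mapping_eqI)
    fix \<alpha>
    show "Poly_Mapping.lookup P \<alpha> = Poly_Mapping.lookup (func_op (Poly_Mapping.lookup P 0)) \<alpha>"
      using assms by (cases "\<alpha> = 0")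
        (auto simp: func_op_eq lookup_single when_def weight_le_def in_keys_iff mdeg_eq_0_iff)
  qed
qed

lemma func_op_eq_0_iff: "(func_op a :: ('i, 'k) lpdo) = 0 \<longleftrightarrow> a = 0"
  by (metis func_op_eq lookup_single_eq lookup_zero single_zero)

text \<open>
  By additivity of the order a divisor of \<open>1\<close> has order zero.
\<close>

lemma left_invertible_imp_func_op:
  assumes "R \<odot> B = func_op 1"
  obtains f where "f \<noteq> 0" "B = func_op f"
proof -
  have "R \<odot> B \<noteq> 0" using assms by (simp add: func_op_eq_0_iff)
  then have "R \<noteq> 0" "B \<noteq> 0"
    by (auto simp: op_mult_def)
  from exists_top_key[OF weight_mdeg this] obtain \<beta> \<gamma> where
    "\<beta> + \<gamma> \<in> Poly_Mapping.keys (R \<odot> B)" and B: "weight_le mdeg (mdeg \<gamma>) B" by blast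
  then have "\<beta> + \<gamma> = 0" using assms by (simp add: func_op_eq)
  then have "mdeg \<beta> + mdeg \<gamma> = 0" by (metis mdeg_add mdeg_eq_0_iff)
  then have "weight_le mdeg 0 B" using B by simp
  then obtain f where f: "B = func_op f" by (rule weight_le_mdeg_0)
  with \<open>B \<noteq> 0\<close> have "f \<noteq> 0" by (simp add: func_op_eq_0_iff)
  then show ?thesis using f that by blast
qed

section \<open>Division by a first-order operator\<close>

abbreviation free_of :: "'i \<Rightarrow> ('i, 'k) lpdo \<Rightarrow> bool" where
  "free_of t \<equiv> weight_le (\<lambda>\<alpha>. \<alpha> t) 0"

lemma free_of_mult: "free_of t P \<Longrightarrow> free_of t Q \<Longrightarrow> free_of t (P \<odot> Q)"
  using weight_le_mult[OF weight_eval[of t], of 0 P 0 Q] by simp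

lemma free_of_func_op: "free_of t (func_op a)"
  by (rule weight_le_func_op[OF weight_eval])

lemma lookup_first_order: "Poly_Mapping.lookup (deriv_op t + func_op m) (unit_index t) = (1 :: 'k)"
proof -
  have "unit_index t \<noteq> 0" by (auto simp: fun_eq_iff unit_index_apply)
  then show ?thesis by (simp add: deriv_op_eq func_op_eq lookup_add lookup_single)
qed

text \<open>
  A multiple of \<open>\<partial>\<^sub>t + m\<close> by a nonzero operator has positive degree in \<open>\<partial>\<^sub>t\<close>, so remainders free of
  \<open>\<partial>\<^sub>t\<close> are unique and \<open>\<partial>\<^sub>t + m\<close> may be cancelled on the right.
\<close>

lemma free_of_mult_first_order_imp_zero:
  assumes "free_of t (P \<odot> (deriv_op t + func_op m))"
  shows "P = 0"
proof (rule ccontr)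
  let ?M = "deriv_op t + func_op m :: ('i, 'k) lpdo"
  assume P: "P \<noteq> 0"
  have key: "unit_index t \<in> Poly_Mapping.keys ?M"
    by (simp add: in_keys_iff lookup_first_order)
  then have "?M \<noteq> 0" by auto
  from exists_top_key[OF weight_eval P this, of t] obtain \<beta> \<gamma>
    where "\<beta> + \<gamma> \<in> Poly_Mapping.keys (P \<odot> ?M)" and M: "weight_le (\<lambda>\<alpha>. \<alpha> t) (\<gamma> t) ?M" by blast
  then have "(\<beta> + \<gamma>) t = 0" using assms by (auto simp: weight_le_def)
  moreover have "unit_index t t \<le> \<gamma> t" using M key by (auto simp: weight_le_def)
  ultimately show False by (simp add: unit_index_apply)
qed

text \<open>
  The operators that can be divided with remainder are closed under all generating operations. The
  only interesting case is multiplication by \<open>\<partial>\<^sub>t\<close> itself, where the remainder \<open>B\<close> contributes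
  \<open>\<partial>\<^sub>t B = B (\<partial>\<^sub>t + m) + (\<partial>\<^sub>tB - B m)\<close>, with the coefficients of \<open>B\<close> differentiated in
  the last bracket.
\<close>

lemma division_by_first_order:
  "\<exists>C B. P = C \<odot> (deriv_op t + func_op m) + B \<and> free_of t B"
proof (induction P rule: lpdo_generate_induct[OF df, case_names one add scale deriv])
  case one
  have "func_op 1 = 0 \<odot> (deriv_op t + func_op m) + func_op 1 \<and> free_of t (func_op 1)"
    by (simp add: op_mult_zero_left free_of_func_op)
  then show ?case by blast
next
  case (add P Q)
  then obtain C B C' B' where "P = C \<odot> (deriv_op t + func_op m) + B" "free_of t B"
    "Q = C' \<odot> (deriv_op t + func_op m) + B'" "free_of t B'" by blast
  then have "P + Q = (C + C') \<odot> (deriv_op t + func_op m) + (B + B') \<and> free_of t (B + B')"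
    by (simp add: op_mult_add_left weight_le_add)
  then show ?case by blast
next
  case (scale P a)
  then obtain C B where P: "P = C \<odot> (deriv_op t + func_op m) + B" and B: "free_of t B" by blast
  have "op_scale a P = (func_op a \<odot> C) \<odot> (deriv_op t + func_op m) + func_op a \<odot> B"
    unfolding P op_mult_func_op[OF df, symmetric] op_mult_assoc op_mult_add_right ..
  then show ?case using free_of_mult[OF free_of_func_op B] by blast
next
  case (deriv P i)
  let ?M = "deriv_op t + func_op m"
  obtain C B where P: "P = C \<odot> ?M + B" and B: "free_of t B" using deriv by blast
  have iP: "op_deriv D i P = (deriv_op i \<odot> C) \<odot> ?M + deriv_op i \<odot> B"
    unfolding P deriv_op_mult[symmetric] op_mult_assoc op_mult_add_right ..
  show ?case
  proof (cases "i = t")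
    case False
    then have "free_of t (deriv_op i)" by (intro weight_le_deriv_op) (simp add: unit_index_apply)
    then show ?thesis using iP free_of_mult B by blast
  next
    case True
    have "op_deriv D i P = (deriv_op i \<odot> C + B) \<odot> ?M + (coeff_deriv D t B - B \<odot> func_op m)"
      using iP unfolding True deriv_op_commutator[of t B]
      by (simp add: op_mult_add_left op_mult_add_right)
    then show ?thesis
      using weight_le_diff weight_le_coeff_deriv[OF B] free_of_mult[OF B free_of_func_op] by blast
  qed
qed

section \<open>First-order Darboux transformations\<close>

lemma lookup_op_symbol:
  fixes P :: "('i, 'k) lpdo"
  shows "Poly_Mapping.lookup (op_symbol P) \<alpha> = (if mdeg \<alpha> = op_order P then Poly_Mapping.lookup P \<alpha> else 0)"
  unfolding op_symbol_def lookup_sum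
  by (auto simp: lookup_single when_def in_keys_iff)

lemma weight_le_op_order: "weight_le mdeg (op_order P) P"
  by (simp add: weight_le_def op_order_def)

lemma exists_key_of_op_order:
  fixes P :: "('i, 'k) lpdo"
  assumes "P \<noteq> 0"
  shows "\<exists>\<alpha>\<in>Poly_Mapping.keys P. mdeg \<alpha> = op_order P"
proof -
  have "Poly_Mapping.keys P \<noteq> {}" using assms by simp
  then have "op_order P = Max (mdeg ` Poly_Mapping.keys P)" by (simp add: op_order_def)
  moreover have "Max (mdeg ` Poly_Mapping.keys P) \<in> mdeg ` Poly_Mapping.keys P"
    using assms by simp
  ultimately show ?thesis by auto
qed

text \<open>
  \<open>(N - \<partial>\<^sub>t) L = (L\<^sub>1 - L) M + (L M - \<partial>\<^sub>t L)\<close>. As the principal symbols of \<open>L\<close> and \<open>L\<^sub>1\<close> agree and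
  the leading parts of \<open>L M\<close> and \<open>\<partial>\<^sub>t L\<close> cancel, the right side has order at most that of \<open>L\<close>;
  hence \<open>N - \<partial>\<^sub>t\<close> has order zero.
\<close>

lemma intertwiner_first_order:
  assumes L: "L \<noteq> 0" and symbol: "op_symbol L = op_symbol L1"
    and NL: "N \<odot> L = L1 \<odot> (deriv_op t + func_op m)"
  obtains n where "N = deriv_op t + func_op n"
proof -
  let ?M = "deriv_op t + func_op m"
  let ?N = "N - deriv_op t"
  define d where "d = op_order L"
  obtain \<alpha> where \<alpha>: "\<alpha> \<in> Poly_Mapping.keys L" "mdeg \<alpha> = d"
    using exists_key_of_op_order[OF L] d_def by blast
  have "Poly_Mapping.lookup (op_symbol L1) \<alpha> \<noteq> 0"
    using \<alpha> by (simp add: symbol[symmetric] lookup_op_symbol d_def in_keys_iff)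
  then have d1: "op_order L1 = d" using \<alpha>(2) by (metis lookup_op_symbol)
  have Ld: "weight_le mdeg d L" and L1d: "weight_le mdeg d L1"
    using weight_le_op_order[of L] weight_le_op_order[of L1] by (simp_all add: d1 d_def)
  \<comment> \<open>for \<open>d = 0\<close> the bound \<open>d - 1\<close> is truncated, so that case is recorded separately\<close>
  have "weight_le mdeg (d - 1) (L1 - L) \<and> (d = 0 \<longrightarrow> L1 - L = 0)"
  proof -
    have lower: "mdeg \<beta> < d" if \<beta>: "\<beta> \<in> Poly_Mapping.keys (L1 - L)" for \<beta>
    proof -
      have "mdeg \<beta> \<le> d" using weight_le_diff[OF L1d Ld] \<beta> by (simp add: weight_le_def)
      moreover have "mdeg \<beta> \<noteq> d"
      proof
        assume "mdeg \<beta> = d"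
        then have "Poly_Mapping.lookup L1 \<beta> = Poly_Mapping.lookup L \<beta>"
          using lookup_op_symbol[of L \<beta>] lookup_op_symbol[of L1 \<beta>] by (simp add: symbol d1 d_def)
        then show False using \<beta> by (simp add: in_keys_iff lookup_minus)
      qed
      ultimately show ?thesis by simp
    qed
    show ?thesis
    proof
      show "weight_le mdeg (d - 1) (L1 - L)" unfolding weight_le_def using lower by fastforce
      show "d = 0 \<longrightarrow> L1 - L = 0" using lower by (metis Poly_Mapping.keys_eq_empty ex_in_conv less_nat_zero_code)
    qed
  qed
  moreover have M1: "weight_le mdeg 1 ?M"
    using weight_le_deriv_op[of mdeg t 1] weight_le_func_op[OF weight_mdeg, of m]
    by (intro weight_le_add) (auto simp: weight_le_def)
  ultimately have "weight_le mdeg d ((L1 - L) \<odot> ?M)"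
    using weight_le_mult[OF weight_mdeg, of "d - 1" "L1 - L" 1 ?M]
    by (cases "d = 0") (auto simp: op_mult_zero_left weight_le_zero)
  moreover have "weight_le mdeg d (L \<odot> func_op m)"
    using weight_le_mult[OF weight_mdeg Ld weight_le_func_op[OF weight_mdeg, of m]] by simp
  moreover have "?N \<odot> L = (L1 - L) \<odot> ?M + (L \<odot> func_op m - coeff_deriv D t L)"
    by (simp add: op_mult_diff_left NL deriv_op_commutator[of t L] op_mult_add_right)
  ultimately have Nd: "weight_le mdeg d (?N \<odot> L)"
    by (simp add: weight_le_add weight_le_diff weight_le_coeff_deriv Ld)
  have "weight_le mdeg 0 ?N"
  proof (cases "?N = 0")
    case False
    from exists_top_key[OF weight_mdeg this L] obtain \<beta> \<gamma> where
      key: "\<beta> + \<gamma> \<in> Poly_Mapping.keys (?N \<odot> L)" and N: "weight_le mdeg (mdeg \<beta>) ?N"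
      and \<gamma>: "weight_le mdeg (mdeg \<gamma>) L" by blast
    have "d \<le> mdeg \<gamma>" using \<gamma> \<alpha> by (auto simp: weight_le_def)
    moreover have "mdeg \<beta> + mdeg \<gamma> \<le> d" using Nd key by (auto simp: weight_le_def mdeg_add[symmetric])
    ultimately have "mdeg \<beta> = 0" by simp
    then show ?thesis using N by simp
  qed (simp add: weight_le_zero)
  then obtain n where "?N = func_op n" by (rule weight_le_mdeg_0)
  then have "N = deriv_op t + func_op n" by (simp add: algebra_simps)
  then show ?thesis by (rule that)
qed

text \<open>
  \<open>N B\<close> equals \<open>B M\<close> up to a term free of \<open>\<partial>\<^sub>t\<close>, while \<open>N L = L\<^sub>1 M\<close> makes it a multiple of \<open>M\<close>;
  uniqueness of remainders gives both equations at once.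
\<close>

lemma intertwining_of_remainder:
  assumes M: "M = deriv_op t + func_op m" and N: "N = deriv_op t + func_op n"
    and NL: "N \<odot> L = L1 \<odot> M" and L: "L = C \<odot> M + B" and B: "free_of t B"
  shows "N \<odot> B = B \<odot> M" and "L1 = N \<odot> C + B"
proof -
  have NB: "N \<odot> B = B \<odot> M + (coeff_deriv D t B - B \<odot> func_op m + func_op n \<odot> B)"
    unfolding N M by (simp add: op_mult_add_left op_mult_add_right deriv_op_commutator[of t B])
  have "N \<odot> C \<odot> M + N \<odot> B = L1 \<odot> M"
    unfolding NL[symmetric] by (simp add: L op_mult_add_right op_mult_assoc)
  then have eq: "(L1 - N \<odot> C - B) \<odot> M = N \<odot> B - B \<odot> M"
    unfolding op_mult_diff_left by (simp add: algebra_simps)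
  have "free_of t (coeff_deriv D t B - B \<odot> func_op m + func_op n \<odot> B)"
    by (intro weight_le_add weight_le_diff weight_le_coeff_deriv free_of_mult free_of_func_op B)
  then have "free_of t ((L1 - N \<odot> C - B) \<odot> M)" unfolding eq NB by simp
  then have zero: "L1 - N \<odot> C - B = 0"
    unfolding M by (rule free_of_mult_first_order_imp_zero)
  then show "L1 = N \<odot> C + B" by (simp add: algebra_simps)
  show "N \<odot> B = B \<odot> M" using eq unfolding zero by (simp add: op_mult_zero_left)
qed

text \<open>
  In \<open>1 = A M + E L\<close> replace \<open>L\<close> by its remainder \<open>B\<close> modulo \<open>M\<close>, and \<open>E\<close> by its remainder \<open>R\<close>
  modulo \<open>N\<close>, which is possible because \<open>N B = B M\<close>. What is left is \<open>1 = R B\<close> up to a multiple of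
  \<open>M\<close> that has to vanish, so \<open>B\<close> is a function \<open>f\<close>, and \<open>N f = f M\<close> is the formula for \<open>N\<close>.
\<close>

lemma type_I_of_unit_ideal:
  assumes M: "M = deriv_op t + func_op m" and N: "N = deriv_op t + func_op n"
    and NL: "N \<odot> L = L1 \<odot> M" and unit: "A \<odot> M + E \<odot> L = func_op 1"
  shows "type_I D M N L L1"
proof -
  obtain C B where L: "L = C \<odot> M + B" and B: "free_of t B"
    using division_by_first_order[of L t m] M by blast
  note NB = intertwining_of_remainder(1)[OF M N NL L B] and L1 = intertwining_of_remainder(2)[OF M N NL L B]
  obtain G R where E: "E = G \<odot> N + R" and R: "free_of t R"
    using division_by_first_order[of E t n] N by blast
  have "E \<odot> B = G \<odot> B \<odot> M + R \<odot> B"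
    by (simp add: E op_mult_add_left op_mult_assoc NB)
  then have eq: "(A + E \<odot> C + G \<odot> B) \<odot> M = func_op 1 - R \<odot> B"
    using unit by (simp add: L op_mult_add_left op_mult_add_right op_mult_assoc algebra_simps)
  have "free_of t (func_op 1 - R \<odot> B)"
    by (intro weight_le_diff free_of_func_op free_of_mult R B)
  then have "A + E \<odot> C + G \<odot> B = 0"
    unfolding eq[symmetric] unfolding M by (rule free_of_mult_first_order_imp_zero)
  then have "R \<odot> B = func_op 1" using eq by (simp add: op_mult_zero_left)
  then obtain f where f: "f \<noteq> 0" and Bf: "B = func_op f" by (rule left_invertible_imp_func_op)
  have "conj_op D f M = N \<odot> func_op f \<odot> func_op (1 / f)"
    by (simp add: conj_op_def op_mult_assoc[symmetric] NB[unfolded Bf])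
  then have "conj_op D f M = N"
    using f by (simp add: op_mult_assoc func_op_mult_func_op op_mult_func_one)
  then show ?thesis unfolding type_I_def using f L L1 Bf by auto
qed

lemma det_2_2:
  fixes A :: "'a::comm_ring_1 mat"
  assumes A: "A \<in> carrier_mat 2 2"
  shows "det A = A $$ (0, 0) * A $$ (1, 1) - A $$ (0, 1) * A $$ (1, 0)"
proof -
  have minor: "det (mat_delete A 0 j) = A $$ (1, 1 - j)" if "j < 2" for j
  proof -
    have "mat_delete A 0 j \<in> carrier_mat 1 1" using A by (simp add: mat_delete_def)
    then show ?thesis using A that
      by (subst det_single) (auto simp: mat_delete_def)
  qed
  have "det A = (\<Sum>j<2. A $$ (0, j) * cofactor A 0 j)"
    by (rule laplace_expansion_row[OF A]) simp
  then show ?thesis by (simp add: cofactor_def minor lessThan_Suc numeral_2_eq_2)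
qed

text \<open>
  No change of variables is made: \<open>M\<psi> = 0\<close> says \<open>m = -\<psi>\<^sub>t / \<psi>\<close>, which is the Wronskian formula for
  the single function \<open>\<psi>\<close>.
\<close>

lemma wronskian_type_of_common_solution:
  assumes M: "M = deriv_op t + func_op m" and \<psi>: "\<psi> \<noteq> 0"
    and M\<psi>: "op_apply D M \<psi> = 0" and L\<psi>: "op_apply D L \<psi> = 0"
  shows "wronskian_type D M L"
  unfolding wronskian_type_def
proof (intro exI conjI allI)
  let ?I = "\<lambda>i k :: 'i. if i = k then 1 else 0 :: 'k"
  have I: "(\<Sum>j\<in>UNIV. ?I i j * c j) = c i" for i and c :: "'i \<Rightarrow> 'k"
    by (simp add: if_distrib[of "\<lambda>x. x * _"] cong: if_cong)
  show "change_of_variables D D"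
    unfolding change_of_variables_def using df
    by (intro conjI exI[of _ ?I]) (simp_all add: I)
  show "[\<psi>] \<noteq> []" by simp
  show "set [\<psi>] \<subseteq> op_ker D L" using L\<psi> by (simp add: op_ker_def)
  show "lin_indep D [\<psi>]" using \<psi> by (simp add: lin_indep_def)
  have W1: "wronskian (D t) [\<psi>] = \<psi>"
    by (simp add: wronskian_def det_single)
  show "wronskian (D t) [\<psi>] \<noteq> 0" using \<psi> by (simp add: W1)
  fix g
  have "det (mat 2 2 (\<lambda>(r, j). (D t ^^ r) ([\<psi>, g] ! j))) = \<psi> * D t g - g * D t \<psi>"
    by (subst det_2_2) auto
  then have W2: "wronskian (D t) ([\<psi>] @ [g]) = \<psi> * D t g - g * D t \<psi>"
    by (simp add: wronskian_def numeral_2_eq_2)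
  have "D t \<psi> = - (m * \<psi>)"
    using M\<psi> by (simp add: M op_apply_deriv_func eq_neg_iff_add_eq_0)
  then show "op_apply D M g = wronskian (D t) ([\<psi>] @ [g]) / wronskian (D t) [\<psi>]"
    using \<psi> unfolding W1 W2 by (simp add: M op_apply_deriv_func field_simps)
qed

theorem type_I_or_wronskian_type:
  assumes closed: "differentially_closed D \<or> contains_solutions D"
    and darboux: "darboux D M N L L1" and M: "M = deriv_op t + func_op m"
  shows "type_I D M N L L1 \<or> wronskian_type D M L"
proof (cases "\<exists>A E. A \<odot> M + E \<odot> L = func_op 1")
  case True
  then obtain A E where unit: "A \<odot> M + E \<odot> L = func_op 1" by blast
  have NL: "N \<odot> L = L1 \<odot> M" and symbol: "op_symbol L = op_symbol L1"
    using darboux by (simp_all add: darboux_def)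
  have "L \<noteq> 0"
  proof
    assume "L = 0"
    then have "A \<odot> M = func_op 1" using unit by (simp add: op_mult_def)
    then have "A = 0"
      using free_of_func_op[of t 1] free_of_mult_first_order_imp_zero[of t A m] M by simp
    then show False
      using \<open>A \<odot> M = func_op 1\<close> func_op_eq_0_iff[of 1] by (simp add: op_mult_zero_left)
  qed
  from intertwiner_first_order[OF this symbol NL[unfolded M]]
  obtain n where "N = deriv_op t + func_op n" .
  from type_I_of_unit_ideal[OF M this NL unit] show ?thesis ..
next
  case False
  define J where "J = {A \<odot> M + E \<odot> L | A E. True}"
  have J: "A \<odot> M + E \<odot> L \<in> J" for A E by (auto simp: J_def)
  have "\<exists>\<psi>. \<psi> \<noteq> 0 \<and> (\<forall>P\<in>{M, L}. op_apply D P \<psi> = 0)"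
  proof (rule linear_nullstellensatz[OF df closed])
    show "finite {M, L}" by simp
    show "{M, L} \<subseteq> J"
      using J[of "func_op 1" 0] J[of 0 "func_op 1"] by (simp add: func_one_op_mult op_mult_zero_left)
    show "0 \<in> J" using J[of 0 0] by (simp add: op_mult_zero_left)
    show "func_op 1 \<notin> J"
    proof
      assume "func_op 1 \<in> J"
      then obtain A E where "func_op 1 = A \<odot> M + E \<odot> L" by (auto simp: J_def)
      then show False using False by metis
    qed
  next
    fix P Q
    assume "P \<in> J" "Q \<in> J"
    then obtain A E A' E' where "P = A \<odot> M + E \<odot> L" "Q = A' \<odot> M + E' \<odot> L" by (auto simp: J_def)
    then have "P + Q = (A + A') \<odot> M + (E + E') \<odot> L" by (simp add: op_mult_add_left)
    then show "P + Q \<in> J" using J by simp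
  next
    fix A P
    assume "P \<in> J"
    then obtain A' E' where "P = A' \<odot> M + E' \<odot> L" by (auto simp: J_def)
    then have "A \<odot> P = (A \<odot> A') \<odot> M + (A \<odot> E') \<odot> L" by (simp add: op_mult_add_right op_mult_assoc)
    then show "A \<odot> P \<in> J" using J by simp
  qed
  then show ?thesis using wronskian_type_of_common_solution[OF M] by blast
qed

end

theorem theorem4p1:
  fixes D :: "'i::finite \<Rightarrow> 'k::field_char_0 \<Rightarrow> 'k"
    and t :: 'i
    and L L1 M N :: "('i, 'k) lpdo"
    and m :: 'k
  assumes "diff_field D"
    and "differentially_closed D \<or> contains_solutions D"
    and "darboux D M N L L1"
    and "darboux_order D M L = 1"
    and "M = deriv_op t + func_op m"
  shows "type_I D M N L L1 \<or> wronskian_type D M L"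
  using assms(1,2,3,5) by (rule type_I_or_wronskian_type)

end
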